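(* Let $\mathcal{P}:\mathbf{Str0DBiFrm}\to\mathbf{Frm}$ be the functor that takes the first part of a strictly zero-dimensional biframe. Then the congruence biframe functor $\mathbb{C}:\mathbf{Frm}\to\mathbf{Str0DBiFrm}$ is left adjoint to $\mathcal{P}$.
   Context: A biframe is a triple $L=(L_0,L_1,L_2)$ where $L_0$ is a frame (the total part) and $L_1,L_2$ are subframes of $L_0$ (the first and second parts) whose union generates $L_0$. A biframe homomorphism $f:L\to M$ is a frame homomorphism $L_0\to M_0$ mapping $L_i$ into $M_i$ for $i=1,2$. A biframe $L$ is strictly zero-dimensional if every $a\in L_1$ is complemented in $L_0$ with its complement lying in $L_2$, and these complements generate $L_2$ (as a frame). $\mathbf{Str0DBiFrm}$ is the category of strictly zero-dimensional biframes and biframe homomorphisms; $\mathbf{Frm}$ is the category of frames. $\mathcal{P}$ sends $L$ to $L_1$ and $f$ to its restriction $L_1\to M_1$. For a frame $L$, let $\mathbb{C}L$ also denote the frame of all frame congruences on $L$ ordered by inclusion (a congruence is an equivalence relation closed under finite meets and arbitrary joins in $L\times L$). For $a\in L$ let $\nabla_a=\langle(0,a)\rangle$ and $\Delta_a=\langle(a,1)\rangle$ be the congruences generated by the indicated pairs; these are complements in $\mathbb{C}L$ and $a\mapsto\nabla_a$ is an injective frame homomorphism $L \to \mathbb{C}L$. The congruence biframe is $\mathbb{C}L=(\mathbb{C}L,\nabla L,\Delta L)$ where $\nabla L=\{\nabla_a\mid a\in L\}$ and $\Delta L$ is the subframe generated by $\{\Delta_a\mid a\in L\}$; it is strictly zero-dimensional.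 For a frame homomorphism $f:L\to M$, $\mathbb{C}f$ is the unique frame homomorphism with $\mathbb{C}f(\nabla_a)=\nabla_{f(a)}$ for all $a\in L$; it is a biframe homomorphism. *)

theory Defs
  imports "HOL-Algebra.Complete_Lattice" "HOL-Library.FuncSet"
begin

section \<open>The category of frames\<close>

text \<open>
  Objects are carrier-based, so that subframes are again objects and the frames involved may
  live in different types. Morphisms are extensional functions (value \<^term>\<open>undefined\<close> off the
  carrier of the domain), so that equality of morphisms is the equality of HOL; composition is
  \<^const>\<open>compose\<close> and identities are \<open>\<lambda>x\<in>A. x\<close>.
\<close>

locale frame = complete_lattice L for L (structure) +
  assumes meet_Sup_distrib:
    "\<lbrakk>a \<in> carrier L; S \<subseteq> carrier L\<rbrakk> \<Longrightarrow> a \<sqinter> (\<Squnion> S) = \<Squnion> ((\<lambda>s. a \<sqinter> s) ` S)"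

definition frame_hom :: "'a gorder \<Rightarrow> 'b gorder \<Rightarrow> ('a \<Rightarrow> 'b) set" where
  "frame_hom L M = {f \<in> carrier L \<rightarrow>\<^sub>E carrier M.
     f \<top>\<^bsub>L\<^esub> = \<top>\<^bsub>M\<^esub> \<and>
     (\<forall>a\<in>carrier L. \<forall>b\<in>carrier L. f (a \<sqinter>\<^bsub>L\<^esub> b) = f a \<sqinter>\<^bsub>M\<^esub> f b) \<and>
     (\<forall>S. S \<subseteq> carrier L \<longrightarrow> f (\<Squnion>\<^bsub>L\<^esub> S) = \<Squnion>\<^bsub>M\<^esub> (f ` S))}"

definition subframe :: "'a set \<Rightarrow> 'a gorder \<Rightarrow> bool" where
  "subframe S L \<longleftrightarrow> S \<subseteq> carrier L \<and> \<top>\<^bsub>L\<^esub> \<in> S \<and>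
     (\<forall>a\<in>S. \<forall>b\<in>S. a \<sqinter>\<^bsub>L\<^esub> b \<in> S) \<and>
     (\<forall>X. X \<subseteq> S \<longrightarrow> \<Squnion>\<^bsub>L\<^esub> X \<in> S)"

definition generated_subframe :: "'a gorder \<Rightarrow> 'a set \<Rightarrow> 'a set" where
  "generated_subframe L X = \<Inter> {S. subframe S L \<and> X \<subseteq> S}"

definition is_complement :: "'a gorder \<Rightarrow> 'a \<Rightarrow> 'a \<Rightarrow> bool" where
  "is_complement L a b \<longleftrightarrow> a \<in> carrier L \<and> b \<in> carrier L \<and>
     a \<sqinter>\<^bsub>L\<^esub> b = \<bottom>\<^bsub>L\<^esub> \<and> a \<squnion>\<^bsub>L\<^esub> b = \<top>\<^bsub>L\<^esub>"

section \<open>The category of strictly zero-dimensional biframes\<close>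

record 'a biframe =
  total_part :: "'a gorder"
  first_part :: "'a set"
  second_part :: "'a set"

definition is_biframe :: "'a biframe \<Rightarrow> bool" where
  "is_biframe M \<longleftrightarrow> frame (total_part M) \<and>
     subframe (first_part M) (total_part M) \<and>
     subframe (second_part M) (total_part M) \<and>
     generated_subframe (total_part M) (first_part M \<union> second_part M) = carrier (total_part M)"

definition biframe_hom :: "'a biframe \<Rightarrow> 'b biframe \<Rightarrow> ('a \<Rightarrow> 'b) set" where
  "biframe_hom M N = {g \<in> frame_hom (total_part M) (total_part N).
     g ` first_part M \<subseteq> first_part N \<and> g ` second_part M \<subseteq> second_part N}"

definition strictly_zero_dimensional :: "'a biframe \<Rightarrow> bool" where
  "strictly_zero_dimensional M \<longleftrightarrow> is_biframe M \<and>
     (\<forall>a\<in>first_part M. \<exists>b\<in>second_part M. is_complement (total_part M) a b) \<and>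
     generated_subframe (total_part M)
       {b. \<exists>a\<in>first_part M. is_complement (total_part M) a b} = second_part M"

section \<open>The first part functor\<close>

definition first_frame :: "'a biframe \<Rightarrow> 'a gorder" where
  "first_frame M = (total_part M)\<lparr>carrier := first_part M\<rparr>"

definition first_map :: "'a biframe \<Rightarrow> ('a \<Rightarrow> 'b) \<Rightarrow> 'a \<Rightarrow> 'b" where
  "first_map M g = restrict g (first_part M)"

section \<open>The congruence biframe functor\<close>

text \<open>The empty meet needs no clause below: \<open>(\<top>, \<top>)\<close> is in every reflexive relation.\<close>

definition frame_congruence :: "'a gorder \<Rightarrow> ('a \<times> 'a) set \<Rightarrow> bool" where
  "frame_congruence L \<theta> \<longleftrightarrow> \<theta> \<subseteq> carrier L \<times> carrier L \<and> equiv (carrier L) \<theta> \<and>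
     (\<forall>a b c d. (a, b) \<in> \<theta> \<longrightarrow> (c, d) \<in> \<theta> \<longrightarrow> (a \<sqinter>\<^bsub>L\<^esub> c, b \<sqinter>\<^bsub>L\<^esub> d) \<in> \<theta>) \<and>
     (\<forall>R. R \<subseteq> \<theta> \<longrightarrow> (\<Squnion>\<^bsub>L\<^esub> (fst ` R), \<Squnion>\<^bsub>L\<^esub> (snd ` R)) \<in> \<theta>)"

definition generated_congruence :: "'a gorder \<Rightarrow> ('a \<times> 'a) set \<Rightarrow> ('a \<times> 'a) set" where
  "generated_congruence L R = \<Inter> {\<theta>. frame_congruence L \<theta> \<and> R \<subseteq> \<theta>}"

definition nabla :: "'a gorder \<Rightarrow> 'a \<Rightarrow> ('a \<times> 'a) set" where
  "nabla L a = generated_congruence L {(\<bottom>\<^bsub>L\<^esub>, a)}"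

definition delta :: "'a gorder \<Rightarrow> 'a \<Rightarrow> ('a \<times> 'a) set" where
  "delta L a = generated_congruence L {(a, \<top>\<^bsub>L\<^esub>)}"

definition cong_frame :: "'a gorder \<Rightarrow> ('a \<times> 'a) set gorder" where
  "cong_frame L = \<lparr>carrier = {\<theta>. frame_congruence L \<theta>}, eq = (=), le = (\<subseteq>)\<rparr>"

definition cong_biframe :: "'a gorder \<Rightarrow> ('a \<times> 'a) set biframe" where
  "cong_biframe L =
    \<lparr>total_part = cong_frame L,
     first_part = nabla L ` carrier L,
     second_part = generated_subframe (cong_frame L) (delta L ` carrier L)\<rparr>"

definition is_cong_map ::
  "'a gorder \<Rightarrow> 'b gorder \<Rightarrow> ('a \<Rightarrow> 'b) \<Rightarrow> (('a \<times> 'a) set \<Rightarrow> ('b \<times> 'b) set) \<Rightarrow> bool" where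
  "is_cong_map L M f g \<longleftrightarrow> g \<in> frame_hom (cong_frame L) (cong_frame M) \<and>
     (\<forall>a\<in>carrier L. g (nabla L a) = nabla M (f a))"

definition cong_map ::
  "'a gorder \<Rightarrow> 'b gorder \<Rightarrow> ('a \<Rightarrow> 'b) \<Rightarrow> ('a \<times> 'a) set \<Rightarrow> ('b \<times> 'b) set" where
  "cong_map L M f = (THE g. is_cong_map L M f g)"

section \<open>Transposition\<close>

text \<open>
  The adjunction relates frames in a type \<open>'a\<close> to biframes in a type \<open>'b\<close>, while the congruence
  biframe of a frame in \<open>'a\<close> lives in \<open>('a \<times> 'a) set\<close>. As HOL has no quantifier over types inside
  a formula, a family of bijections indexed by all frames and biframes cannot be bound by an
  existential quantifier; it is given explicitly, by composing the first part of a biframe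
  homomorphism with \<open>\<nabla>\<close>, the unit of the adjunction.
\<close>

definition unit_map :: "'a gorder \<Rightarrow> 'a \<Rightarrow> ('a \<times> 'a) set" where
  "unit_map L = (\<lambda>a\<in>carrier L. nabla L a)"

definition hom_transpose :: "'a gorder \<Rightarrow> (('a \<times> 'a) set \<Rightarrow> 'b) \<Rightarrow> 'a \<Rightarrow> 'b" where
  "hom_transpose L g = compose (carrier L) (first_map (cong_biframe L) g) (unit_map L)"

section \<open>Category laws\<close>

lemma image_compose: "S \<subseteq> A \<Longrightarrow> compose A g f ` S = g ` f ` S"
  unfolding image_image by (rule image_cong) (auto simp: compose_eq)

lemma id_frame_hom:
  assumes "frame L"
  shows "(\<lambda>x\<in>carrier L. x) \<in> frame_hom L L"
proof -
  interpret frame L by (rule assms)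
  have "(\<lambda>x\<in>carrier L. x) ` S = S" if "S \<subseteq> carrier L" for S
  proof -
    have "(\<lambda>x\<in>carrier L. x) ` S = (\<lambda>x. x) ` S"
      using that by (intro image_cong) auto
    then show ?thesis by simp
  qed
  then show ?thesis
    by (simp add: frame_hom_def)
qed

lemma frame_homD:
  assumes "f \<in> frame_hom L M"
  shows "f \<in> carrier L \<rightarrow> carrier M" "f \<top>\<^bsub>L\<^esub> = \<top>\<^bsub>M\<^esub>"
    "\<lbrakk>a \<in> carrier L; b \<in> carrier L\<rbrakk> \<Longrightarrow> f (a \<sqinter>\<^bsub>L\<^esub> b) = f a \<sqinter>\<^bsub>M\<^esub> f b"
    "S \<subseteq> carrier L \<Longrightarrow> f (\<Squnion>\<^bsub>L\<^esub> S) = \<Squnion>\<^bsub>M\<^esub> (f ` S)"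
  using assms by (simp_all add: frame_hom_def PiE_def)

lemma compose_frame_hom:
  assumes L: "frame L" and f: "f \<in> frame_hom L M" and g: "g \<in> frame_hom M N"
  shows "compose (carrier L) g f \<in> frame_hom L N"
proof -
  interpret frame L by (rule L)
  show ?thesis
    unfolding frame_hom_def
  proof (intro CollectI conjI ballI allI impI)
    show "compose (carrier L) g f \<in> carrier L \<rightarrow>\<^sub>E carrier N"
      using funcset_compose[OF frame_homD(1)[OF f] frame_homD(1)[OF g]] by (simp add: PiE_def)
    show "compose (carrier L) g f \<top>\<^bsub>L\<^esub> = \<top>\<^bsub>N\<^esub>"
      by (simp add: compose_eq frame_homD(2)[OF f] frame_homD(2)[OF g])
  next
    fix a b assume ab: "a \<in> carrier L" "b \<in> carrier L"
    then have "f a \<in> carrier M" "f b \<in> carrier M"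
      using frame_homD(1)[OF f] by (simp_all add: Pi_iff)
    then show "compose (carrier L) g f (a \<sqinter>\<^bsub>L\<^esub> b) =
        compose (carrier L) g f a \<sqinter>\<^bsub>N\<^esub> compose (carrier L) g f b"
      using ab by (simp add: compose_eq frame_homD(3)[OF f] frame_homD(3)[OF g])
  next
    fix S assume S: "S \<subseteq> carrier L"
    then have "f ` S \<subseteq> carrier M"
      using frame_homD(1)[OF f] by (auto simp: Pi_iff)
    then show "compose (carrier L) g f (\<Squnion>\<^bsub>L\<^esub> S) = \<Squnion>\<^bsub>N\<^esub> (compose (carrier L) g f ` S)"
      using S by (simp add: compose_eq image_compose frame_homD(4)[OF f] frame_homD(4)[OF g])
  qed
qed

lemma id_biframe_hom:
  assumes "is_biframe M"
  shows "(\<lambda>x\<in>carrier (total_part M). x) \<in> biframe_hom M M"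
proof -
  have "first_part M \<subseteq> carrier (total_part M)" "second_part M \<subseteq> carrier (total_part M)"
    using assms by (simp_all add: is_biframe_def subframe_def)
  then show ?thesis
    using assms id_frame_hom[of "total_part M"]
    by (auto simp add: biframe_hom_def is_biframe_def)
qed

lemma compose_biframe_hom:
  assumes "is_biframe K" "f \<in> biframe_hom K M" "g \<in> biframe_hom M N"
  shows "compose (carrier (total_part K)) g f \<in> biframe_hom K N"
proof -
  have "first_part K \<subseteq> carrier (total_part K)" "second_part K \<subseteq> carrier (total_part K)"
    using assms(1) by (simp_all add: is_biframe_def subframe_def)
  moreover have "compose (carrier (total_part K)) g f \<in> frame_hom (total_part K) (total_part N)"
    using assms by (intro compose_frame_hom[where M = "total_part M"]) (simp_all add: biframe_hom_def is_biframe_def)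
  moreover have "f ` first_part K \<subseteq> first_part M" "f ` second_part K \<subseteq> second_part M"
      "g ` first_part M \<subseteq> first_part N" "g ` second_part M \<subseteq> second_part N"
    using assms(2,3) by (simp_all add: biframe_hom_def)
  then have "g ` f ` first_part K \<subseteq> first_part N" "g ` f ` second_part K \<subseteq> second_part N"
    by (meson image_mono subset_trans)+
  ultimately show ?thesis
    by (simp add: biframe_hom_def image_compose)
qed

end

theory Submission
  imports Defs
begin

text \<open>
  The functor \<open>\<P>\<close> is faithful, and \<open>\<nabla>\<close> is a universal arrow from each frame to it; the adjunction is
  formal from there.

  Faithfulness (\<open>frame_hom_eq_if_eq_on_first_part\<close>): the elements on which two homomorphisms agree
  form a subframe. Homomorphisms preserve complements, and complements are unique, so
  agreement on the first part of a strictly zero-dimensional biframe propagates to the complements,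
  hence to the second part that they generate, hence to everything. The same reasoning shows that a
  frame homomorphism between the total parts that respects first parts also respects second parts
  (\<open>biframe_homI\<close>). Every uniqueness claim and every functor law reduces in this way to an
  evaluation at the congruences \<open>\<nabla>\<^sub>a\<close>.

  The congruences form a frame because binary meets have a right adjoint: the implication
  \<open>\<theta> \<Rightarrow> \<phi>\<close> consists of the pairs that become \<open>\<phi>\<close>-related under each of the maps
  \<open>a \<mapsto> x \<squnion> (y \<sqinter> a)\<close> with \<open>(x, y) \<in> \<theta>\<close> (\<open>cong_imp_adjoint\<close>). Every congruence \<open>\<theta>\<close> is the join of
  the congruences \<open>\<nabla>\<^sub>b \<sqinter> \<Delta>\<^sub>a\<close> with \<open>(a, b) \<in> \<theta>\<close> (\<open>cong_eq_Sup\<close>), which makes the congruence biframe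
  strictly zero-dimensional.

  Universality (\<open>cong_frame_extension\<close>): let \<open>f : L \<rightarrow> N\<close> be a frame homomorphism whose values have
  complements. The decomposition of \<open>\<theta>\<close> forces the extension along \<open>\<nabla>\<close> to be
  \<open>g \<theta> = \<Squnion>{f b \<sqinter> (f a)\<^sup>c | (a, b) \<in> \<theta>}\<close>. It preserves joins because it is left adjoint to the map that
  sends \<open>n\<close> to the kernel congruence of \<open>x \<mapsto> n \<squnion> f x\<close>. It preserves binary meets because, for
  \<open>(a, b) \<in> \<theta>\<close> and \<open>(c, d) \<in> \<psi>\<close>, the pair \<open>(b \<sqinter> d \<sqinter> (a \<squnion> c), b \<sqinter> d)\<close> lies in \<open>\<theta> \<inter> \<psi>\<close> and accounts for
  the meet of the two contributions.
\<close>

section \<open>Frames, subframes and frame homomorphisms\<close>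

context frame
begin

lemma le_meet_iff:
  "\<lbrakk>x \<in> carrier L; y \<in> carrier L; z \<in> carrier L\<rbrakk> \<Longrightarrow> z \<sqsubseteq> x \<sqinter> y \<longleftrightarrow> z \<sqsubseteq> x \<and> z \<sqsubseteq> y"
  by (meson le_trans meet_closed meet_le meet_left meet_right)

lemma join_le_iff:
  "\<lbrakk>x \<in> carrier L; y \<in> carrier L; z \<in> carrier L\<rbrakk> \<Longrightarrow> x \<squnion> y \<sqsubseteq> z \<longleftrightarrow> x \<sqsubseteq> z \<and> y \<sqsubseteq> z"
  by (meson le_trans join_closed join_le join_left join_right)

lemma Sup_le_iff:
  "\<lbrakk>S \<subseteq> carrier L; z \<in> carrier L\<rbrakk> \<Longrightarrow> \<Squnion>S \<sqsubseteq> z \<longleftrightarrow> (\<forall>s\<in>S. s \<sqsubseteq> z)"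
  by (meson le_trans subsetD sup_closed sup_least sup_upper)

lemma Sup_eqI:
  assumes "S \<subseteq> carrier L" "z \<in> carrier L" "\<And>s. s \<in> S \<Longrightarrow> s \<sqsubseteq> z"
    "\<And>u. \<lbrakk>u \<in> carrier L; \<And>s. s \<in> S \<Longrightarrow> s \<sqsubseteq> u\<rbrakk> \<Longrightarrow> z \<sqsubseteq> u"
  shows "\<Squnion>S = z"
  using assms by (intro le_antisym) (auto simp: Sup_le_iff sup_upper)

lemma Sup_empty: "\<Squnion>{} = \<bottom>"
  by (rule Sup_eqI) auto

lemma join_commute: "x \<squnion> y = y \<squnion> x"
  by (simp add: join_def insert_commute)

lemma meet_commute: "x \<sqinter> y = y \<sqinter> x"
  by (simp add: meet_def insert_commute)

lemma meet_absorb: "\<lbrakk>x \<in> carrier L; y \<in> carrier L; x \<sqsubseteq> y\<rbrakk> \<Longrightarrow> x \<sqinter> y = x"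
  by (metis le_iff_join)

lemma join_absorb: "\<lbrakk>x \<in> carrier L; y \<in> carrier L; x \<sqsubseteq> y\<rbrakk> \<Longrightarrow> x \<squnion> y = y"
  by (metis le_iff_meet)

lemma meet_absorb2: "\<lbrakk>x \<in> carrier L; y \<in> carrier L; x \<sqsubseteq> y\<rbrakk> \<Longrightarrow> y \<sqinter> x = x"
  by (simp add: meet_absorb meet_commute[of y x])

lemma join_absorb2: "\<lbrakk>x \<in> carrier L; y \<in> carrier L; x \<sqsubseteq> y\<rbrakk> \<Longrightarrow> y \<squnion> x = y"
  by (simp add: join_absorb join_commute[of y x])

lemma meet_join_distrib:
  assumes "a \<in> carrier L" "b \<in> carrier L" "c \<in> carrier L"
  shows "a \<sqinter> (b \<squnion> c) = (a \<sqinter> b) \<squnion> (a \<sqinter> c)"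
  using meet_Sup_distrib[of a "{b, c}"] assms by (simp add: join_def)

lemma meet_Sup_Sup_le:
  assumes X: "X \<subseteq> carrier L" and Y: "Y \<subseteq> carrier L" and z: "z \<in> carrier L"
    and le: "\<And>x y. \<lbrakk>x \<in> X; y \<in> Y\<rbrakk> \<Longrightarrow> x \<sqinter> y \<sqsubseteq> z"
  shows "\<Squnion>X \<sqinter> \<Squnion>Y \<sqsubseteq> z"
proof -
  have "\<Squnion>Y \<sqinter> x \<sqsubseteq> z" if "x \<in> X" for x
  proof -
    have x: "x \<in> carrier L" using that X by auto
    have "(\<lambda>y. x \<sqinter> y) ` Y \<subseteq> carrier L" using x Y by auto
    then have "x \<sqinter> \<Squnion>Y \<sqsubseteq> z"
      using le that z by (auto simp: meet_Sup_distrib[OF x Y] Sup_le_iff)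
    then show ?thesis by (simp add: meet_commute[of _ x])
  qed
  moreover have "(\<lambda>x. \<Squnion>Y \<sqinter> x) ` X \<subseteq> carrier L" using X sup_closed[OF Y] by auto
  ultimately show ?thesis
    using z by (auto simp: meet_commute[of "\<Squnion>X"] meet_Sup_distrib[OF sup_closed[OF Y] X] Sup_le_iff)
qed

lemma join_meet_distrib:
  assumes [simp]: "a \<in> carrier L" "b \<in> carrier L" "c \<in> carrier L"
  shows "a \<squnion> (b \<sqinter> c) = (a \<squnion> b) \<sqinter> (a \<squnion> c)"
proof (rule le_antisym)
  show "a \<squnion> (b \<sqinter> c) \<sqsubseteq> (a \<squnion> b) \<sqinter> (a \<squnion> c)"
    by (auto simp: le_meet_iff join_le_iff join_left intro: le_trans[OF meet_left join_right]
        le_trans[OF meet_right join_right])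
  have "(a \<squnion> b) \<sqinter> (a \<squnion> c) = ((a \<squnion> b) \<sqinter> a) \<squnion> ((a \<squnion> b) \<sqinter> c)"
    by (simp add: meet_join_distrib)
  also have "(a \<squnion> b) \<sqinter> c = (c \<sqinter> a) \<squnion> (c \<sqinter> b)"
    by (simp add: meet_commute[of _ c] meet_join_distrib)
  finally have "(a \<squnion> b) \<sqinter> (a \<squnion> c) = ((a \<squnion> b) \<sqinter> a) \<squnion> ((c \<sqinter> a) \<squnion> (c \<sqinter> b))" .
  moreover have "c \<sqinter> b \<sqsubseteq> a \<squnion> (b \<sqinter> c)"
    by (simp add: meet_commute[of c b] join_right)
  moreover have "(a \<squnion> b) \<sqinter> a \<sqsubseteq> a \<squnion> (b \<sqinter> c)" "c \<sqinter> a \<sqsubseteq> a \<squnion> (b \<sqinter> c)"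
    by (auto intro: le_trans[OF meet_right join_left])
  ultimately show "(a \<squnion> b) \<sqinter> (a \<squnion> c) \<sqsubseteq> a \<squnion> (b \<sqinter> c)"
    by (simp add: join_le_iff)
qed simp_all

lemma join_Sup_distrib:
  assumes "a \<in> carrier L" "S \<subseteq> carrier L" "S \<noteq> {}"
  shows "a \<squnion> \<Squnion>S = \<Squnion>((\<lambda>s. a \<squnion> s) ` S)"
proof (rule Sup_eqI[symmetric])
  show "s \<sqsubseteq> a \<squnion> \<Squnion>S" if "s \<in> (\<lambda>s. a \<squnion> s) ` S" for s
  proof -
    from that obtain t where t: "t \<in> S" "s = a \<squnion> t" by auto
    then have "t \<in> carrier L" "t \<sqsubseteq> \<Squnion>S"
      using assms by (auto simp: sup_upper)
    then show ?thesis
      using t assms by (auto simp: join_le_iff join_left intro: le_trans[OF _ join_right])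
  qed
  fix u assume u: "u \<in> carrier L" and ub: "\<And>s. s \<in> (\<lambda>s. a \<squnion> s) ` S \<Longrightarrow> s \<sqsubseteq> u"
  have "a \<sqsubseteq> u \<and> s \<sqsubseteq> u" if "s \<in> S" for s
    using that ub[of "a \<squnion> s"] u assms by (auto simp: join_le_iff)
  then show "a \<squnion> \<Squnion>S \<sqsubseteq> u"
    using assms u by (auto simp: join_le_iff Sup_le_iff)
qed (use assms in auto)

end

text \<open>
  This adjunction is the form in which complements are used: it makes them unique, and it turns a
  bound on \<open>f b \<sqinter> (f a)\<^sup>c\<close> into an inequality that mentions no complement.
\<close>

lemma meet_complement_le_iff:
  fixes L (structure)
  assumes "frame L" and c: "is_complement L a c" and [simp]: "x \<in> carrier L" "y \<in> carrier L"
  shows "x \<sqinter> c \<sqsubseteq> y \<longleftrightarrow> x \<sqsubseteq> a \<squnion> y"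
proof -
  interpret frame L by fact
  have [simp]: "a \<in> carrier L" "c \<in> carrier L" and bot: "a \<sqinter> c = \<bottom>" and top: "a \<squnion> c = \<top>"
    using c by (simp_all add: is_complement_def)
  show ?thesis
  proof
    assume *: "x \<sqinter> c \<sqsubseteq> y"
    have "x = x \<sqinter> (a \<squnion> c)"
      by (simp add: top meet_absorb)
    also have "\<dots> = (x \<sqinter> a) \<squnion> (x \<sqinter> c)"
      by (simp add: meet_join_distrib)
    also have "\<dots> \<sqsubseteq> a \<squnion> y"
      using * by (auto simp: join_le_iff intro: le_trans[OF meet_right join_left]
          le_trans[OF _ join_right])
    finally show "x \<sqsubseteq> a \<squnion> y" by simp
  next
    assume *: "x \<sqsubseteq> a \<squnion> y"
    have "x \<sqinter> c \<sqsubseteq> (a \<squnion> y) \<sqinter> c"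
      using * by (auto simp: le_meet_iff meet_right intro: le_trans[OF meet_left])
    also have "\<dots> = (c \<sqinter> a) \<squnion> (c \<sqinter> y)"
      by (simp add: meet_commute[of _ c] meet_join_distrib)
    also have "\<dots> \<sqsubseteq> y"
      by (simp add: meet_commute[of c a] bot join_le_iff meet_right)
    finally show "x \<sqinter> c \<sqsubseteq> y" by simp
  qed
qed

lemma complement_unique:
  fixes L (structure)
  assumes "frame L" and c: "is_complement L a c" "is_complement L a d"
  shows "c = d"
proof -
  interpret frame L by fact
  have le: "c' \<sqsubseteq> d'" if "is_complement L a c'" "is_complement L a d'" for c' d'
    using meet_complement_le_iff[OF \<open>frame L\<close> that(1), of c' d'] that
    by (simp add: is_complement_def meet_absorb)
  then show ?thesis
    using c by (intro le_antisym) (auto simp: is_complement_def)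
qed


lemma subframe_Sup_closed: "\<lbrakk>subframe S L; X \<subseteq> S\<rbrakk> \<Longrightarrow> \<Squnion>\<^bsub>L\<^esub> X \<in> S"
  by (simp add: subframe_def)

lemma subframe_carrier:
  assumes "frame L"
  shows "subframe (carrier L) L"
proof -
  interpret frame L by fact
  show ?thesis by (simp add: subframe_def)
qed

lemma subframe_generated:
  assumes "frame L" "X \<subseteq> carrier L"
  shows "subframe (generated_subframe L X) L"
proof -
  have "generated_subframe L X \<subseteq> carrier L"
    using subframe_carrier[OF assms(1)] assms(2) by (auto simp: generated_subframe_def)
  moreover have "\<Squnion>\<^bsub>L\<^esub> Y \<in> generated_subframe L X" if "Y \<subseteq> generated_subframe L X" for Y
    using that unfolding generated_subframe_def
    by (auto intro!: subframe_Sup_closed)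
  ultimately show ?thesis
    unfolding subframe_def[of "generated_subframe L X"]
    by (auto simp: generated_subframe_def subframe_def[of _ L])
qed

lemma generated_subframe_least: "\<lbrakk>subframe S L; X \<subseteq> S\<rbrakk> \<Longrightarrow> generated_subframe L X \<subseteq> S"
  by (auto simp: generated_subframe_def)

lemma generated_subframe_superset: "X \<subseteq> generated_subframe L X"
  by (auto simp: generated_subframe_def)

text \<open>
  Infima of arbitrary subsets of a subframe exist but differ in general from those of the ambient
  frame, so only finite meets are transferred.
\<close>

lemma subframe_structure:
  assumes "frame L" "subframe S L"
  shows subframe_complete_lattice: "complete_lattice (L\<lparr>carrier := S\<rparr>)"
    and subframe_Sup: "X \<subseteq> S \<Longrightarrow> \<Squnion>\<^bsub>L\<lparr>carrier := S\<rparr>\<^esub> X = \<Squnion>\<^bsub>L\<^esub> X"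
    and subframe_meet: "\<lbrakk>x \<in> S; y \<in> S\<rbrakk> \<Longrightarrow> x \<sqinter>\<^bsub>L\<lparr>carrier := S\<rparr>\<^esub> y = x \<sqinter>\<^bsub>L\<^esub> y"
    and subframe_top: "\<top>\<^bsub>L\<lparr>carrier := S\<rparr>\<^esub> = \<top>\<^bsub>L\<^esub>"
proof -
  interpret frame L by fact
  let ?S = "L\<lparr>carrier := S\<rparr>"
  have S: "S \<subseteq> carrier L" and top: "\<top>\<^bsub>L\<^esub> \<in> S"
    and meet: "\<And>a b. \<lbrakk>a \<in> S; b \<in> S\<rbrakk> \<Longrightarrow> a \<sqinter>\<^bsub>L\<^esub> b \<in> S"
    and Sup: "\<And>X. X \<subseteq> S \<Longrightarrow> \<Squnion>\<^bsub>L\<^esub> X \<in> S"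
    using assms(2) by (simp_all add: subframe_def)
  have "weak_partial_order ?S"
    using S weak_partial_order_axioms weak_partial_order_subset by blast
  then interpret S: partial_order ?S
    by (simp add: partial_order_def partial_order_axioms_def eq_is_equal)
  have lub: "least ?S (\<Squnion>\<^bsub>L\<^esub> X) (Upper ?S X)" if "X \<subseteq> S" for X
    using that S Sup[OF that]
    by (intro least_UpperI) (auto simp: Upper_def Sup_le_iff sup_upper subset_iff)
  have glb: "greatest ?S (\<Squnion>\<^bsub>L\<^esub> {s \<in> S. \<forall>x\<in>X. s \<sqsubseteq>\<^bsub>L\<^esub> x}) (Lower ?S X)" if "X \<subseteq> S" for X
    using that S Sup[of "{s \<in> S. \<forall>x\<in>X. s \<sqsubseteq>\<^bsub>L\<^esub> x}"]
    by (intro greatest_LowerI) (auto simp: Lower_def subset_iff intro!: sup_upper sup_least)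
  show cl: "complete_lattice ?S"
    using lub glb by (intro S.complete_latticeI) auto
  interpret S: complete_lattice ?S by (rule cl)
  show "\<Squnion>\<^bsub>?S\<^esub> X = \<Squnion>\<^bsub>L\<^esub> X" if "X \<subseteq> S"
    using lub[OF that] S.sup_lub[of X] that S.least_unique by simp
  show "x \<sqinter>\<^bsub>?S\<^esub> y = x \<sqinter>\<^bsub>L\<^esub> y" if "x \<in> S" "y \<in> S"
  proof (rule S.greatest_unique)
    show "greatest ?S (x \<sqinter>\<^bsub>?S\<^esub> y) (Lower ?S {x, y})"
      using S.inf_glb[of "{x, y}"] that by (simp add: meet_def)
    show "greatest ?S (x \<sqinter>\<^bsub>L\<^esub> y) (Lower ?S {x, y})"
      using that S meet[OF that]
      by (intro greatest_LowerI) (auto simp: Lower_def subset_iff le_meet_iff meet_left meet_right)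
  qed
  show "\<top>\<^bsub>?S\<^esub> = \<top>\<^bsub>L\<^esub>"
    using top S S.top_closed S.top_higher[of "\<top>\<^bsub>L\<^esub>"] by (intro S.le_antisym) auto
qed

lemma subframe_frame:
  assumes "frame L" "subframe S L"
  shows "frame (L\<lparr>carrier := S\<rparr>)"
proof -
  interpret frame L by fact
  have S: "S \<subseteq> carrier L" using assms(2) by (simp add: subframe_def)
  have Sup: "\<Squnion>\<^bsub>L\<^esub> X \<in> S" if "X \<subseteq> S" for X
    using that assms(2) by (simp add: subframe_def)
  have meet: "a \<sqinter>\<^bsub>L\<^esub> b \<in> S" if "a \<in> S" "b \<in> S" for a b
    using that assms(2) by (simp add: subframe_def)
  show ?thesis
  proof (intro frame.intro frame_axioms.intro subframe_complete_lattice[OF assms])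
    fix a X assume "a \<in> carrier (L\<lparr>carrier := S\<rparr>)" "X \<subseteq> carrier (L\<lparr>carrier := S\<rparr>)"
    then have aX: "a \<in> S" "X \<subseteq> S" by simp_all
    then have "(\<lambda>s. a \<sqinter>\<^bsub>L\<lparr>carrier := S\<rparr>\<^esub> s) ` X = (\<lambda>s. a \<sqinter>\<^bsub>L\<^esub> s) ` X"
      by (intro image_cong) (auto simp: subframe_meet[OF assms])
    moreover have "(\<lambda>s. a \<sqinter>\<^bsub>L\<^esub> s) ` X \<subseteq> S"
      using aX meet by auto
    moreover have "a \<in> carrier L" "X \<subseteq> carrier L"
      using aX S by auto
    ultimately show "a \<sqinter>\<^bsub>L\<lparr>carrier := S\<rparr>\<^esub> (\<Squnion>\<^bsub>L\<lparr>carrier := S\<rparr>\<^esub> X) =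
        \<Squnion>\<^bsub>L\<lparr>carrier := S\<rparr>\<^esub> ((\<lambda>s. a \<sqinter>\<^bsub>L\<lparr>carrier := S\<rparr>\<^esub> s) ` X)"
      using aX Sup[of X] by (simp add: subframe_Sup[OF assms] subframe_meet[OF assms] meet_Sup_distrib)
  qed
qed

lemma frame_hom_into_subframe:
  assumes "frame L" "subframe S L"
  shows "f \<in> frame_hom K (L\<lparr>carrier := S\<rparr>) \<longleftrightarrow> f \<in> frame_hom K L \<and> f ` carrier K \<subseteq> S"
proof (cases "f ` carrier K \<subseteq> S")
  case True
  have "S \<subseteq> carrier L" using assms(2) by (simp add: subframe_def)
  then have "f \<in> carrier K \<rightarrow>\<^sub>E S \<longleftrightarrow> f \<in> carrier K \<rightarrow>\<^sub>E carrier L"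
    using True by (auto simp: PiE_def Pi_def)
  moreover have "\<Squnion>\<^bsub>L\<lparr>carrier := S\<rparr>\<^esub> (f ` X) = \<Squnion>\<^bsub>L\<^esub> (f ` X)" if "X \<subseteq> carrier K" for X
    using that True by (intro subframe_Sup[OF assms]) blast
  moreover have "f x \<sqinter>\<^bsub>L\<lparr>carrier := S\<rparr>\<^esub> f y = f x \<sqinter>\<^bsub>L\<^esub> f y" if "x \<in> carrier K" "y \<in> carrier K" for x y
    using that True by (intro subframe_meet[OF assms]) auto
  ultimately show ?thesis
    using True by (simp add: frame_hom_def subframe_top[OF assms])
qed (auto simp: frame_hom_def)

lemma frame_hom_restrict:
  assumes "frame L" "subframe S L" "f \<in> frame_hom L K"
  shows "restrict f S \<in> frame_hom (L\<lparr>carrier := S\<rparr>) K"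
proof -
  have S: "S \<subseteq> carrier L" "\<top>\<^bsub>L\<^esub> \<in> S" using assms(2) by (simp_all add: subframe_def)
  have Sup: "\<Squnion>\<^bsub>L\<^esub> X \<in> S" if "X \<subseteq> S" for X
    using that assms(2) by (simp add: subframe_def)
  have meet: "a \<sqinter>\<^bsub>L\<^esub> b \<in> S" if "a \<in> S" "b \<in> S" for a b
    using that assms(2) by (simp add: subframe_def)
  have im: "restrict f S ` X = f ` X" if "X \<subseteq> S" for X
    using that by (intro image_cong) auto
  show ?thesis
    unfolding frame_hom_def
  proof (intro CollectI conjI ballI allI impI)
    show "restrict f S \<in> carrier (L\<lparr>carrier := S\<rparr>) \<rightarrow>\<^sub>E carrier K"
      using S frame_homD(1)[OF assms(3)] by (auto simp: Pi_iff)
  next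
    fix X assume "X \<subseteq> carrier (L\<lparr>carrier := S\<rparr>)"
    then have X: "X \<subseteq> S" by simp
    then show "restrict f S (\<Squnion>\<^bsub>L\<lparr>carrier := S\<rparr>\<^esub> X) = \<Squnion>\<^bsub>K\<^esub> (restrict f S ` X)"
      unfolding im[OF X]
      using S(1) by (simp add: subframe_Sup[OF assms(1,2)] Sup frame_homD(4)[OF assms(3)])
  qed (use S in \<open>auto simp: subframe_top[OF assms(1,2)] subframe_meet[OF assms(1,2)] meet
      frame_homD(2,3)[OF assms(3)] subset_iff\<close>)
qed

context
  fixes L :: "'a gorder" and M :: "'b gorder" and f
  assumes L: "frame L" and M: "frame M" and f: "f \<in> frame_hom L M"
begin

interpretation L: frame L by (rule L)
interpretation M: frame M by (rule M)

lemma frame_hom_closed: "x \<in> carrier L \<Longrightarrow> f x \<in> carrier M"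
  using frame_homD(1)[OF f] by (auto simp: Pi_iff)

lemma frame_hom_bottom: "f \<bottom>\<^bsub>L\<^esub> = \<bottom>\<^bsub>M\<^esub>"
  using frame_homD(4)[OF f, of "{}"] by (simp add: L.Sup_empty M.Sup_empty)

lemma frame_hom_join:
  "\<lbrakk>x \<in> carrier L; y \<in> carrier L\<rbrakk> \<Longrightarrow> f (x \<squnion>\<^bsub>L\<^esub> y) = f x \<squnion>\<^bsub>M\<^esub> f y"
  using frame_homD(4)[OF f, of "{x, y}"] by (simp add: join_def)

lemma frame_hom_complement: "is_complement L a b \<Longrightarrow> is_complement M (f a) (f b)"
  unfolding is_complement_def
  by (metis frame_hom_bottom frame_hom_closed frame_hom_join frame_homD(2,3)[OF f])

lemma subframe_vimage:
  assumes "subframe T M"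
  shows "subframe {x \<in> carrier L. f x \<in> T} L"
proof -
  have "f (\<Squnion>\<^bsub>L\<^esub> X) \<in> T" if "X \<subseteq> {x \<in> carrier L. f x \<in> T}" for X
  proof -
    have "f ` X \<subseteq> T" "X \<subseteq> carrier L" using that by auto
    then show ?thesis
      by (simp add: frame_homD(4)[OF f] subframe_Sup_closed[OF assms])
  qed
  then show ?thesis
    using assms
    unfolding subframe_def[of "{x \<in> carrier L. f x \<in> T}"]
    by (auto simp: frame_homD(2,3)[OF f] subframe_def[of T] intro!: L.sup_closed)
qed

lemma subframe_equalizer:
  assumes g: "g \<in> frame_hom L M"
  shows "subframe {x \<in> carrier L. f x = g x} L"
proof -
  have "f (\<Squnion>\<^bsub>L\<^esub> X) = g (\<Squnion>\<^bsub>L\<^esub> X)" if "X \<subseteq> {x \<in> carrier L. f x = g x}" for X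
  proof -
    have "f ` X = g ` X" using that by (intro image_cong) auto
    moreover have "X \<subseteq> carrier L" using that by auto
    ultimately show ?thesis
      by (simp add: frame_homD(4)[OF f] frame_homD(4)[OF g])
  qed
  then show ?thesis
    unfolding subframe_def
    by (auto simp: frame_homD(2,3)[OF f] frame_homD(2,3)[OF g] intro!: L.sup_closed)
qed

end

section \<open>Frame congruences\<close>

context
  fixes L :: "'a gorder" and \<theta>
  assumes \<theta>: "frame_congruence L \<theta>"
begin

lemma cong_closed:
  assumes "(a, b) \<in> \<theta>"
  shows "a \<in> carrier L" "b \<in> carrier L"
  using \<theta> assms by (auto simp: frame_congruence_def)

lemma cong_refl: "a \<in> carrier L \<Longrightarrow> (a, a) \<in> \<theta>"
  using \<theta> by (auto simp: frame_congruence_def equiv_def refl_on_def)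

lemma cong_sym: "(a, b) \<in> \<theta> \<Longrightarrow> (b, a) \<in> \<theta>"
  using \<theta> by (auto simp: frame_congruence_def equiv_def dest: symD)

lemma cong_trans: "\<lbrakk>(a, b) \<in> \<theta>; (b, c) \<in> \<theta>\<rbrakk> \<Longrightarrow> (a, c) \<in> \<theta>"
  using \<theta> by (auto simp: frame_congruence_def equiv_def dest: transD)

lemma cong_meet: "\<lbrakk>(a, b) \<in> \<theta>; (c, d) \<in> \<theta>\<rbrakk> \<Longrightarrow> (a \<sqinter>\<^bsub>L\<^esub> c, b \<sqinter>\<^bsub>L\<^esub> d) \<in> \<theta>"
  using \<theta> by (auto simp: frame_congruence_def)

lemma cong_Sup: "R \<subseteq> \<theta> \<Longrightarrow> (\<Squnion>\<^bsub>L\<^esub> (fst ` R), \<Squnion>\<^bsub>L\<^esub> (snd ` R)) \<in> \<theta>"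
  using \<theta> by (auto simp: frame_congruence_def)

lemma cong_join: "\<lbrakk>(a, b) \<in> \<theta>; (c, d) \<in> \<theta>\<rbrakk> \<Longrightarrow> (a \<squnion>\<^bsub>L\<^esub> c, b \<squnion>\<^bsub>L\<^esub> d) \<in> \<theta>"
  using cong_Sup[of "{(a, b), (c, d)}"] by (simp add: join_def)

end

lemma frame_congruenceI:
  assumes "\<theta> \<subseteq> carrier L \<times> carrier L"
    "\<And>a. a \<in> carrier L \<Longrightarrow> (a, a) \<in> \<theta>"
    "\<And>a b. (a, b) \<in> \<theta> \<Longrightarrow> (b, a) \<in> \<theta>"
    "\<And>a b c. \<lbrakk>(a, b) \<in> \<theta>; (b, c) \<in> \<theta>\<rbrakk> \<Longrightarrow> (a, c) \<in> \<theta>"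
    "\<And>a b c d. \<lbrakk>(a, b) \<in> \<theta>; (c, d) \<in> \<theta>\<rbrakk> \<Longrightarrow> (a \<sqinter>\<^bsub>L\<^esub> c, b \<sqinter>\<^bsub>L\<^esub> d) \<in> \<theta>"
    "\<And>R. R \<subseteq> \<theta> \<Longrightarrow> (\<Squnion>\<^bsub>L\<^esub> (fst ` R), \<Squnion>\<^bsub>L\<^esub> (snd ` R)) \<in> \<theta>"
  shows "frame_congruence L \<theta>"
  unfolding frame_congruence_def
proof (intro conjI)
  show "equiv (carrier L) \<theta>"
    using assms(1-4) by (intro equivI refl_onI symI transI) blast+
qed (use assms(1,5,6) in blast)+

lemma frame_congruence_Id:
  assumes "frame L"
  shows "frame_congruence L (Id_on (carrier L))"
proof -
  interpret frame L by fact
  have "(\<Squnion>\<^bsub>L\<^esub> (fst ` R), \<Squnion>\<^bsub>L\<^esub> (snd ` R)) \<in> Id_on (carrier L)" if "R \<subseteq> Id_on (carrier L)" for R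
  proof -
    have "fst ` R = snd ` R" using that by (intro image_cong) auto
    moreover have "snd ` R \<subseteq> carrier L" using that by auto
    ultimately show ?thesis by (simp add: Id_on_iff)
  qed
  then show ?thesis
    by (intro frame_congruenceI) auto
qed

text \<open>
  Only nonempty joins and binary meets need to be preserved, so translations \<open>x \<mapsto> a \<squnion> x\<close> and
  \<open>x \<mapsto> a \<sqinter> x\<close> qualify although they are not frame homomorphisms. Every congruence that is
  described explicitly below is an instance or an intersection of instances.
\<close>

lemma frame_congruence_pullback:
  fixes L :: "'a gorder" and N :: "'b gorder"
  assumes "frame L" and \<phi>: "frame_congruence N \<phi>"
    and p: "\<And>x. x \<in> carrier L \<Longrightarrow> p x \<in> carrier N"
    and p_meet: "\<And>x y. \<lbrakk>x \<in> carrier L; y \<in> carrier L\<rbrakk> \<Longrightarrow> p (x \<sqinter>\<^bsub>L\<^esub> y) = p x \<sqinter>\<^bsub>N\<^esub> p y"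
    and p_Sup: "\<And>S. \<lbrakk>S \<subseteq> carrier L; S \<noteq> {}\<rbrakk> \<Longrightarrow> p (\<Squnion>\<^bsub>L\<^esub> S) = \<Squnion>\<^bsub>N\<^esub> (p ` S)"
  shows "frame_congruence L {(x, y). x \<in> carrier L \<and> y \<in> carrier L \<and> (p x, p y) \<in> \<phi>}"
    (is "frame_congruence L ?\<theta>")
proof -
  interpret frame L by fact
  have Sup: "(\<Squnion>\<^bsub>L\<^esub> (fst ` R), \<Squnion>\<^bsub>L\<^esub> (snd ` R)) \<in> ?\<theta>" if R: "R \<subseteq> ?\<theta>" for R
  proof (cases "R = {}")
    case True
    then show ?thesis using cong_refl[OF \<phi> p] by simp
  next
    case False
    have carr: "fst ` R \<subseteq> carrier L" "snd ` R \<subseteq> carrier L" using R by auto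
    have "map_prod p p ` R \<subseteq> \<phi>" using R by auto
    from cong_Sup[OF \<phi> this] have "(\<Squnion>\<^bsub>N\<^esub> (p ` fst ` R), \<Squnion>\<^bsub>N\<^esub> (p ` snd ` R)) \<in> \<phi>"
      by (simp add: image_image)
    then show ?thesis using False carr by (simp add: p_Sup)
  qed
  show ?thesis
    by (rule frame_congruenceI)
      (use Sup in \<open>auto simp: p_meet intro: cong_refl[OF \<phi>] cong_sym[OF \<phi>] cong_trans[OF \<phi>]
        cong_meet[OF \<phi>] p\<close>)
qed

lemma frame_congruence_kernel_join:
  fixes L :: "'a gorder" and N :: "'b gorder"
  assumes L: "frame L" and N: "frame N" and f: "f \<in> frame_hom L N" and n: "n \<in> carrier N"
  shows "frame_congruence L
    {(x, y). x \<in> carrier L \<and> y \<in> carrier L \<and> n \<squnion>\<^bsub>N\<^esub> f x = n \<squnion>\<^bsub>N\<^esub> f y}"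
proof -
  interpret N: frame N by (rule N)
  note closed = frame_hom_closed[OF L N f]
  have Sup: "n \<squnion>\<^bsub>N\<^esub> f (\<Squnion>\<^bsub>L\<^esub> S) = \<Squnion>\<^bsub>N\<^esub> ((\<lambda>x. n \<squnion>\<^bsub>N\<^esub> f x) ` S)"
    if "S \<subseteq> carrier L" "S \<noteq> {}" for S
  proof -
    have "f ` S \<subseteq> carrier N" using that closed by auto
    then show ?thesis
      using that n N.join_Sup_distrib[of n "f ` S"]
      by (simp add: frame_homD(4)[OF f] image_image)
  qed
  have "frame_congruence L {(x, y). x \<in> carrier L \<and> y \<in> carrier L \<and>
      (n \<squnion>\<^bsub>N\<^esub> f x, n \<squnion>\<^bsub>N\<^esub> f y) \<in> Id_on (carrier N)}"
    using n closed Sup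
    by (intro frame_congruence_pullback[OF L frame_congruence_Id[OF N]])
      (auto simp: frame_homD(3)[OF f] N.join_meet_distrib)
  moreover have "{(x, y). x \<in> carrier L \<and> y \<in> carrier L \<and>
      (n \<squnion>\<^bsub>N\<^esub> f x, n \<squnion>\<^bsub>N\<^esub> f y) \<in> Id_on (carrier N)} =
      {(x, y). x \<in> carrier L \<and> y \<in> carrier L \<and> n \<squnion>\<^bsub>N\<^esub> f x = n \<squnion>\<^bsub>N\<^esub> f y}"
    using n closed by (auto simp: Id_on_iff)
  ultimately show ?thesis by simp
qed

lemma frame_congruence_Inter:
  assumes "\<And>\<theta>. \<theta> \<in> T \<Longrightarrow> frame_congruence L \<theta>" "T \<noteq> {}"
  shows "frame_congruence L (\<Inter>T)"
proof (rule frame_congruenceI)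
  fix R assume "R \<subseteq> \<Inter>T"
  then have "R \<subseteq> \<theta>" if "\<theta> \<in> T" for \<theta> using that by auto
  then show "(\<Squnion>\<^bsub>L\<^esub> (fst ` R), \<Squnion>\<^bsub>L\<^esub> (snd ` R)) \<in> \<Inter>T"
    by (auto intro: cong_Sup[OF assms(1)])
next
  obtain \<theta> where "\<theta> \<in> T" using assms(2) by auto
  then show "\<Inter>T \<subseteq> carrier L \<times> carrier L"
    using cong_closed[OF assms(1)] by auto
qed (auto intro: cong_refl[OF assms(1)] cong_sym[OF assms(1)] cong_meet[OF assms(1)]
    dest: cong_trans[OF assms(1)])

lemma frame_congruence_Int:
  "\<lbrakk>frame_congruence L \<theta>; frame_congruence L \<psi>\<rbrakk> \<Longrightarrow> frame_congruence L (\<theta> \<inter> \<psi>)"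
  using frame_congruence_Inter[of "{\<theta>, \<psi>}" L] by auto

lemma frame_congruence_total:
  assumes "frame L"
  shows "frame_congruence L (carrier L \<times> carrier L)"
proof -
  interpret frame L by fact
  have "fst ` R \<subseteq> carrier L \<and> snd ` R \<subseteq> carrier L" if "R \<subseteq> carrier L \<times> carrier L" for R
    using that by auto
  then show ?thesis by (intro frame_congruenceI) auto
qed

lemma frame_congruence_generated:
  assumes "frame L" "R \<subseteq> carrier L \<times> carrier L"
  shows "frame_congruence L (generated_congruence L R)"
  unfolding generated_congruence_def
  using frame_congruence_total[OF assms(1)] assms(2) by (intro frame_congruence_Inter) auto

lemma generated_congruence_le_iff:
  "frame_congruence L \<theta> \<Longrightarrow> generated_congruence L R \<subseteq> \<theta> \<longleftrightarrow> R \<subseteq> \<theta>"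
  by (auto simp: generated_congruence_def)

lemma generated_congruence_superset: "R \<subseteq> generated_congruence L R"
  by (auto simp: generated_congruence_def)

section \<open>The frame of congruences\<close>

lemma cong_frame_simps [simp]:
  "carrier (cong_frame L) = {\<theta>. frame_congruence L \<theta>}"
  "\<theta> \<sqsubseteq>\<^bsub>cong_frame L\<^esub> \<psi> \<longleftrightarrow> \<theta> \<subseteq> \<psi>"
  by (simp_all add: cong_frame_def)

text \<open>
  The Heyting implication. The map \<open>a \<mapsto> x \<squnion> (y \<sqinter> a)\<close> forces \<open>a\<close> into the interval from \<open>x\<close> to \<open>y\<close>
  (when \<open>x\<close> is below \<open>y\<close>). A congruence \<open>\<theta>\<close> collapses the intervals between its own pairs, and
  the implication asks that \<open>a\<close> and \<open>b\<close> become \<open>\<phi>\<close>-related inside each of these.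
\<close>

definition cong_imp :: "'a gorder \<Rightarrow> ('a \<times> 'a) set \<Rightarrow> ('a \<times> 'a) set \<Rightarrow> ('a \<times> 'a) set" where
  "cong_imp L \<theta> \<phi> = {(a, b). a \<in> carrier L \<and> b \<in> carrier L \<and>
     (\<forall>(x, y)\<in>\<theta>. (x \<squnion>\<^bsub>L\<^esub> (y \<sqinter>\<^bsub>L\<^esub> a), x \<squnion>\<^bsub>L\<^esub> (y \<sqinter>\<^bsub>L\<^esub> b)) \<in> \<phi>)}"

context
  fixes L :: "'a gorder" (structure)
  assumes L: "frame L"
begin

interpretation frame L by (rule L)

lemma cong_frame_partial_order: "partial_order (cong_frame L)"
  by unfold_locales (auto simp: cong_frame_def)

interpretation C: partial_order "cong_frame L" by (rule cong_frame_partial_order)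

lemma generated_congruence_lub:
  assumes "T \<subseteq> {\<theta>. frame_congruence L \<theta>}"
  shows "least (cong_frame L) (generated_congruence L (\<Union>T)) (Upper (cong_frame L) T)"
proof (rule least_UpperI)
  have "\<Union>T \<subseteq> carrier L \<times> carrier L"
    using assms by (auto dest: cong_closed)
  then show "generated_congruence L (\<Union>T) \<in> carrier (cong_frame L)"
    using frame_congruence_generated[OF L] by simp
qed (use assms in \<open>auto simp: Upper_def generated_congruence_le_iff
    intro: generated_congruence_superset[THEN subsetD]\<close>)

lemma cong_frame_complete_lattice: "complete_lattice (cong_frame L)"
proof (rule C.complete_lattice_criterion1)
  show "\<exists>g. greatest (cong_frame L) g (carrier (cong_frame L))"
    using frame_congruence_total[OF L]
    by (intro exI[of _ "carrier L \<times> carrier L"]) (auto simp: greatest_def dest: cong_closed)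
  fix T assume "T \<subseteq> carrier (cong_frame L)" "T \<noteq> {}"
  then show "\<exists>i. greatest (cong_frame L) i (Lower (cong_frame L) T)"
    by (intro exI[of _ "\<Inter>T"] greatest_LowerI)
      (auto simp: Lower_def intro!: frame_congruence_Inter)
qed

interpretation C: complete_lattice "cong_frame L" by (rule cong_frame_complete_lattice)

lemma cong_frame_Sup:
  "T \<subseteq> {\<theta>. frame_congruence L \<theta>} \<Longrightarrow> \<Squnion>\<^bsub>cong_frame L\<^esub> T = generated_congruence L (\<Union>T)"
  using C.least_unique[OF C.sup_lub[of T] generated_congruence_lub[of T]] by simp

lemma cong_frame_meet:
  assumes "frame_congruence L \<theta>" "frame_congruence L \<psi>"
  shows "\<theta> \<sqinter>\<^bsub>cong_frame L\<^esub> \<psi> = \<theta> \<inter> \<psi>"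
proof (rule C.greatest_unique)
  show "greatest (cong_frame L) (\<theta> \<sqinter>\<^bsub>cong_frame L\<^esub> \<psi>) (Lower (cong_frame L) {\<theta>, \<psi>})"
    using C.inf_glb[of "{\<theta>, \<psi>}"] assms by (simp add: meet_def)
  show "greatest (cong_frame L) (\<theta> \<inter> \<psi>) (Lower (cong_frame L) {\<theta>, \<psi>})"
    using assms by (intro greatest_LowerI) (auto simp: Lower_def frame_congruence_Int)
qed

lemma cong_frame_top: "\<top>\<^bsub>cong_frame L\<^esub> = carrier L \<times> carrier L"
  using frame_congruence_total[OF L] C.top_closed C.top_higher[of "carrier L \<times> carrier L"]
  by (auto dest: cong_closed)

lemma cong_frame_bottom: "\<bottom>\<^bsub>cong_frame L\<^esub> = Id_on (carrier L)"
  using frame_congruence_Id[OF L] C.bottom_closed C.bottom_lower[of "Id_on (carrier L)"]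
  by (auto dest: cong_refl)

text \<open>
  Each of the maps \<open>a \<mapsto> x \<squnion> (y \<sqinter> a)\<close> preserves binary meets and nonempty joins, so the implication
  is an intersection of pullbacks of \<open>\<phi>\<close>.
\<close>

lemma frame_congruence_imp:
  assumes \<theta>: "frame_congruence L \<theta>" and \<phi>: "frame_congruence L \<phi>"
  shows "frame_congruence L (cong_imp L \<theta> \<phi>)"
proof -
  let ?P = "\<lambda>(x, y). {(a, b). a \<in> carrier L \<and> b \<in> carrier L \<and>
      (x \<squnion> (y \<sqinter> a), x \<squnion> (y \<sqinter> b)) \<in> \<phi>}"
  have "frame_congruence L (?P (x, y))" if "(x, y) \<in> \<theta>" for x y
  proof -
    have xy [simp]: "x \<in> carrier L" "y \<in> carrier L"
      using cong_closed[OF \<theta> that] by simp_all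
    have meet: "x \<squnion> (y \<sqinter> (a \<sqinter> b)) = (x \<squnion> (y \<sqinter> a)) \<sqinter> (x \<squnion> (y \<sqinter> b))"
      if ab [simp]: "a \<in> carrier L" "b \<in> carrier L" for a b
    proof -
      have "y \<sqinter> (a \<sqinter> b) = (y \<sqinter> a) \<sqinter> (y \<sqinter> b)"
        by (rule le_antisym)
          (auto simp: le_meet_iff meet_left meet_right
            intro: le_trans[OF meet_left] le_trans[OF meet_right])
      then show ?thesis by (simp add: join_meet_distrib)
    qed
    have Sup: "x \<squnion> (y \<sqinter> \<Squnion>S) = \<Squnion>((\<lambda>a. x \<squnion> (y \<sqinter> a)) ` S)"
      if "S \<subseteq> carrier L" "S \<noteq> {}" for S
    proof -
      have "(\<lambda>a. y \<sqinter> a) ` S \<subseteq> carrier L" using that by auto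
      then show ?thesis
        using that by (simp add: meet_Sup_distrib join_Sup_distrib image_image)
    qed
    show ?thesis
      using frame_congruence_pullback[OF L \<phi>, of "\<lambda>a. x \<squnion> (y \<sqinter> a)"] meet Sup by simp
  qed
  then have "frame_congruence L (\<Inter>(?P ` \<theta>))"
    using cong_refl[OF \<theta> top_closed] by (intro frame_congruence_Inter) auto
  moreover have "cong_imp L \<theta> \<phi> = \<Inter>(?P ` \<theta>)"
    using cong_refl[OF \<theta> top_closed] by (auto simp: cong_imp_def)
  ultimately show ?thesis by simp
qed

text \<open>
  From right to left, the images of \<open>a\<close> and \<open>b\<close> under \<open>a \<mapsto> x \<squnion> (y \<sqinter> a)\<close> are both \<open>\<theta>\<close>-related to
  \<open>x\<close>, so a pair in \<open>\<psi>\<close> is mapped into \<open>\<theta> \<inter> \<psi>\<close>. From left to right, a pair \<open>(a, b)\<close> in \<open>\<theta>\<close> is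
  recovered by testing it against the pair \<open>(a \<sqinter> b, a \<squnion> b)\<close> of \<open>\<theta>\<close>, whose map fixes \<open>a\<close> and \<open>b\<close>.
\<close>

lemma cong_imp_adjoint:
  assumes \<theta>: "frame_congruence L \<theta>" and \<psi>: "frame_congruence L \<psi>" and \<phi>: "frame_congruence L \<phi>"
  shows "\<psi> \<subseteq> cong_imp L \<theta> \<phi> \<longleftrightarrow> \<theta> \<inter> \<psi> \<subseteq> \<phi>"
proof
  assume *: "\<theta> \<inter> \<psi> \<subseteq> \<phi>"
  show "\<psi> \<subseteq> cong_imp L \<theta> \<phi>"
  proof clarify
    fix a b assume ab: "(a, b) \<in> \<psi>"
    note [simp] = cong_closed[OF \<psi> ab]
    have "(x \<squnion> (y \<sqinter> a), x \<squnion> (y \<sqinter> b)) \<in> \<phi>" if xy: "(x, y) \<in> \<theta>" for x y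
    proof -
      note [simp] = cong_closed[OF \<theta> xy]
      have collapse: "(x \<squnion> (y \<sqinter> c), x) \<in> \<theta>" if "c \<in> carrier L" for c
      proof -
        have "(x \<squnion> (y \<sqinter> c), x \<squnion> (x \<sqinter> c)) \<in> \<theta>"
          using that by (intro cong_join[OF \<theta>] cong_meet[OF \<theta>] cong_refl[OF \<theta>] cong_sym[OF \<theta> xy]) auto
        moreover have "x \<squnion> (x \<sqinter> c) = x"
          using that by (simp add: join_commute[of x] join_absorb meet_left)
        ultimately show ?thesis by simp
      qed
      have "(x \<squnion> (y \<sqinter> a), x \<squnion> (y \<sqinter> b)) \<in> \<theta>"
        using collapse[of a] collapse[of b] by (auto intro: cong_trans[OF \<theta>] cong_sym[OF \<theta>])
      moreover have "(x \<squnion> (y \<sqinter> a), x \<squnion> (y \<sqinter> b)) \<in> \<psi>"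
        by (intro cong_join[OF \<psi>] cong_meet[OF \<psi>] cong_refl[OF \<psi>] ab) auto
      ultimately show ?thesis using * by auto
    qed
    then show "(a, b) \<in> cong_imp L \<theta> \<phi>"
      by (auto simp: cong_imp_def)
  qed
next
  assume *: "\<psi> \<subseteq> cong_imp L \<theta> \<phi>"
  show "\<theta> \<inter> \<psi> \<subseteq> \<phi>"
  proof clarify
    fix a b assume ab: "(a, b) \<in> \<theta>" "(a, b) \<in> \<psi>"
    note [simp] = cong_closed[OF \<theta> ab(1)]
    have "(a \<sqinter> b, b \<sqinter> b) \<in> \<theta>" "(a \<squnion> b, b \<squnion> b) \<in> \<theta>"
      by (rule cong_meet[OF \<theta> ab(1) cong_refl[OF \<theta>]], simp)
        (rule cong_join[OF \<theta> ab(1) cong_refl[OF \<theta>]], simp)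
    then have "(a \<sqinter> b, a \<squnion> b) \<in> \<theta>"
      by (auto simp: meet_absorb join_absorb intro: cong_trans[OF \<theta>] cong_sym[OF \<theta>])
    then have "((a \<sqinter> b) \<squnion> ((a \<squnion> b) \<sqinter> a), (a \<sqinter> b) \<squnion> ((a \<squnion> b) \<sqinter> b)) \<in> \<phi>"
      using * ab(2) by (auto simp: cong_imp_def)
    moreover have "(a \<sqinter> b) \<squnion> ((a \<squnion> b) \<sqinter> a) = a" "(a \<sqinter> b) \<squnion> ((a \<squnion> b) \<sqinter> b) = b"
      by (simp_all add: meet_commute[of "a \<squnion> b"] meet_absorb join_left join_right join_absorb
          meet_left meet_right)
    ultimately show "(a, b) \<in> \<phi>" by simp
  qed
qed

lemma cong_frame_frame: "frame (cong_frame L)"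
proof (intro frame.intro frame_axioms.intro cong_frame_complete_lattice)
  fix \<theta> T assume "\<theta> \<in> carrier (cong_frame L)" and "T \<subseteq> carrier (cong_frame L)"
  then have \<theta>: "frame_congruence L \<theta>" and T: "T \<subseteq> {\<psi>. frame_congruence L \<psi>}" by simp_all
  have T': "(\<lambda>\<psi>. \<theta> \<sqinter>\<^bsub>cong_frame L\<^esub> \<psi>) ` T = (\<lambda>\<psi>. \<theta> \<inter> \<psi>) ` T"
    using T by (intro image_cong) (auto simp: cong_frame_meet \<theta>)
  have T'': "(\<lambda>\<psi>. \<theta> \<inter> \<psi>) ` T \<subseteq> {\<psi>. frame_congruence L \<psi>}"
    using T by (auto intro: frame_congruence_Int[OF \<theta>])
  let ?S = "generated_congruence L (\<Union>T)"
  let ?\<phi> = "generated_congruence L (\<Union>((\<lambda>\<psi>. \<theta> \<inter> \<psi>) ` T))"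
  have S: "frame_congruence L ?S" and \<phi>: "frame_congruence L ?\<phi>"
    using T T'' by (auto intro!: frame_congruence_generated[OF L] dest: cong_closed)
  have "\<psi> \<subseteq> cong_imp L \<theta> ?\<phi>" if "\<psi> \<in> T" for \<psi>
  proof -
    have "\<theta> \<inter> \<psi> \<subseteq> \<Union>((\<lambda>\<psi>. \<theta> \<inter> \<psi>) ` T)" using that by auto
    then show ?thesis
      using that T cong_imp_adjoint[OF \<theta> _ \<phi>, of \<psi>] generated_congruence_superset by blast
  qed
  then have "?S \<subseteq> cong_imp L \<theta> ?\<phi>"
    unfolding generated_congruence_le_iff[OF frame_congruence_imp[OF \<theta> \<phi>]] by (rule Union_least)
  then have "\<theta> \<inter> ?S \<subseteq> ?\<phi>"
    by (rule cong_imp_adjoint[OF \<theta> S \<phi>, THEN iffD1])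
  moreover have "?\<phi> \<subseteq> \<theta> \<inter> ?S"
    unfolding generated_congruence_le_iff[OF frame_congruence_Int[OF \<theta> S]]
    using generated_congruence_superset by blast
  ultimately have "\<theta> \<inter> ?S = ?\<phi>" by (rule equalityI)
  then show "\<theta> \<sqinter>\<^bsub>cong_frame L\<^esub> \<Squnion>\<^bsub>cong_frame L\<^esub> T =
      \<Squnion>\<^bsub>cong_frame L\<^esub> ((\<lambda>\<psi>. \<theta> \<sqinter>\<^bsub>cong_frame L\<^esub> \<psi>) ` T)"
    by (simp only: T' cong_frame_Sup[OF T] cong_frame_Sup[OF T''] cong_frame_meet[OF \<theta> S])
qed

end

section \<open>The congruence biframe\<close>

context
  fixes L :: "'a gorder" (structure)
  assumes L: "frame L"
begin

interpretation frame L by (rule L)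
interpretation C: frame "cong_frame L" by (rule cong_frame_frame[OF L])

lemma frame_congruence_nabla: "a \<in> carrier L \<Longrightarrow> frame_congruence L (nabla L a)"
  unfolding nabla_def by (intro frame_congruence_generated[OF L]) auto

lemma frame_congruence_delta: "a \<in> carrier L \<Longrightarrow> frame_congruence L (delta L a)"
  unfolding delta_def by (intro frame_congruence_generated[OF L]) auto

lemma nabla_le_iff: "frame_congruence L \<theta> \<Longrightarrow> nabla L a \<subseteq> \<theta> \<longleftrightarrow> (\<bottom>, a) \<in> \<theta>"
  by (simp add: nabla_def generated_congruence_le_iff)

lemma delta_le_iff: "frame_congruence L \<theta> \<Longrightarrow> delta L a \<subseteq> \<theta> \<longleftrightarrow> (a, \<top>) \<in> \<theta>"
  by (simp add: delta_def generated_congruence_le_iff)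

lemma bottom_in_nabla: "(\<bottom>, a) \<in> nabla L a"
  by (simp add: nabla_def generated_congruence_superset[THEN subsetD])

lemma top_in_delta: "(a, \<top>) \<in> delta L a"
  by (simp add: delta_def generated_congruence_superset[THEN subsetD])

text \<open>
  The explicit relation is a congruence, being a kernel of the translation \<open>x \<mapsto> a \<squnion> x\<close>, and it
  contains \<open>(\<bottom>, a)\<close>. Conversely, joining \<open>(\<bottom>, a)\<close> with \<open>x\<close> relates \<open>x\<close> to \<open>a \<squnion> x\<close>.
\<close>

lemma nabla_eq:
  assumes a [simp]: "a \<in> carrier L"
  shows "nabla L a = {(x, y). x \<in> carrier L \<and> y \<in> carrier L \<and> a \<squnion> x = a \<squnion> y}"
proof
  have "frame_congruence L {(x, y). x \<in> carrier L \<and> y \<in> carrier L \<and>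
      (a \<squnion> x, a \<squnion> y) \<in> Id_on (carrier L)}"
    by (intro frame_congruence_pullback[OF L frame_congruence_Id[OF L]])
      (simp_all add: join_meet_distrib join_Sup_distrib)
  moreover have "(\<bottom>, a) \<in> {(x, y). x \<in> carrier L \<and> y \<in> carrier L \<and>
      (a \<squnion> x, a \<squnion> y) \<in> Id_on (carrier L)}"
    by (simp add: Id_on_iff join_absorb2)
  ultimately have "nabla L a \<subseteq> {(x, y). x \<in> carrier L \<and> y \<in> carrier L \<and>
      (a \<squnion> x, a \<squnion> y) \<in> Id_on (carrier L)}"
    by (rule nabla_le_iff[THEN iffD2])
  then show "nabla L a \<subseteq> {(x, y). x \<in> carrier L \<and> y \<in> carrier L \<and> a \<squnion> x = a \<squnion> y}"
    by auto
next
  note \<theta> = frame_congruence_nabla[OF a]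
  have *: "(x, a \<squnion> x) \<in> nabla L a" if x: "x \<in> carrier L" for x
    using cong_join[OF \<theta> bottom_in_nabla cong_refl[OF \<theta> x]] x
    by (simp add: join_absorb)
  show "{(x, y). x \<in> carrier L \<and> y \<in> carrier L \<and> a \<squnion> x = a \<squnion> y} \<subseteq> nabla L a"
  proof clarify
    fix x y assume xy: "x \<in> carrier L" "y \<in> carrier L" "a \<squnion> x = a \<squnion> y"
    then have "(x, a \<squnion> y) \<in> nabla L a" using *[of x] by simp
    then show "(x, y) \<in> nabla L a"
      using *[OF xy(2)] by (rule cong_trans[OF \<theta> _ cong_sym[OF \<theta>]])
  qed
qed

lemma delta_eq:
  assumes a [simp]: "a \<in> carrier L"
  shows "delta L a = {(x, y). x \<in> carrier L \<and> y \<in> carrier L \<and> a \<sqinter> x = a \<sqinter> y}"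
proof
  have meet: "a \<sqinter> (x \<sqinter> y) = (a \<sqinter> x) \<sqinter> (a \<sqinter> y)"
    if [simp]: "x \<in> carrier L" "y \<in> carrier L" for x y
    by (rule le_antisym)
      (auto simp: le_meet_iff meet_left meet_right
        intro: le_trans[OF meet_left] le_trans[OF meet_right])
  have "frame_congruence L {(x, y). x \<in> carrier L \<and> y \<in> carrier L \<and>
      (a \<sqinter> x, a \<sqinter> y) \<in> Id_on (carrier L)}"
    by (intro frame_congruence_pullback[OF L frame_congruence_Id[OF L]])
      (simp_all add: meet_Sup_distrib meet)
  moreover have "(a, \<top>) \<in> {(x, y). x \<in> carrier L \<and> y \<in> carrier L \<and>
      (a \<sqinter> x, a \<sqinter> y) \<in> Id_on (carrier L)}"
    by (simp add: Id_on_iff meet_absorb)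
  ultimately have "delta L a \<subseteq> {(x, y). x \<in> carrier L \<and> y \<in> carrier L \<and>
      (a \<sqinter> x, a \<sqinter> y) \<in> Id_on (carrier L)}"
    by (rule delta_le_iff[THEN iffD2])
  then show "delta L a \<subseteq> {(x, y). x \<in> carrier L \<and> y \<in> carrier L \<and> a \<sqinter> x = a \<sqinter> y}"
    by auto
next
  note \<theta> = frame_congruence_delta[OF a]
  have *: "(a \<sqinter> x, x) \<in> delta L a" if x: "x \<in> carrier L" for x
    using cong_meet[OF \<theta> top_in_delta cong_refl[OF \<theta> x]] x
    by (simp add: meet_absorb2)
  show "{(x, y). x \<in> carrier L \<and> y \<in> carrier L \<and> a \<sqinter> x = a \<sqinter> y} \<subseteq> delta L a"
  proof clarify
    fix x y assume xy: "x \<in> carrier L" "y \<in> carrier L" "a \<sqinter> x = a \<sqinter> y"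
    then have "(a \<sqinter> y, x) \<in> delta L a" using *[of x] by simp
    then show "(x, y) \<in> delta L a"
      using *[OF xy(2)] by (rule cong_trans[OF \<theta> cong_sym[OF \<theta>]])
  qed
qed

lemma nabla_mono: "\<lbrakk>a \<in> carrier L; b \<in> carrier L; a \<sqsubseteq> b\<rbrakk> \<Longrightarrow> nabla L a \<subseteq> nabla L b"
  by (simp add: nabla_le_iff frame_congruence_nabla) (simp add: nabla_eq join_absorb2)

text \<open>
  Disjointness is cancellation in distributive lattices: \<open>x\<close> is determined by \<open>a \<squnion> x\<close> and
  \<open>a \<sqinter> x\<close>. The join is everything since it relates \<open>\<bottom>\<close> to \<open>a\<close> and \<open>a\<close> to \<open>\<top>\<close>.
\<close>

lemma nabla_delta_complement:
  assumes a [simp]: "a \<in> carrier L"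
  shows "is_complement (cong_frame L) (nabla L a) (delta L a)"
proof -
  note N = frame_congruence_nabla[OF a] and D = frame_congruence_delta[OF a]
  have "nabla L a \<inter> delta L a = Id_on (carrier L)"
  proof
    show "nabla L a \<inter> delta L a \<subseteq> Id_on (carrier L)"
    proof clarify
      fix x y assume "(x, y) \<in> nabla L a" "(x, y) \<in> delta L a"
      then have [simp]: "x \<in> carrier L" "y \<in> carrier L"
        and j: "a \<squnion> x = a \<squnion> y" and m: "a \<sqinter> x = a \<sqinter> y"
        by (simp_all add: nabla_eq delta_eq)
      have "x = x \<sqinter> (a \<squnion> x)" by (simp add: meet_absorb join_right)
      also have "\<dots> = (x \<sqinter> a) \<squnion> (x \<sqinter> y)" by (simp add: j meet_join_distrib)
      also have "\<dots> = (y \<sqinter> a) \<squnion> (y \<sqinter> x)" using m by (simp add: meet_commute[of _ a] meet_commute[of x y])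
      also have "\<dots> = y \<sqinter> (a \<squnion> y)" by (simp add: meet_join_distrib flip: j)
      also have "\<dots> = y" by (simp add: meet_absorb join_right)
      finally show "(x, y) \<in> Id_on (carrier L)" by (simp add: Id_on_iff)
    qed
    show "Id_on (carrier L) \<subseteq> nabla L a \<inter> delta L a"
      by (auto intro: cong_refl[OF N] cong_refl[OF D])
  qed
  moreover have "carrier L \<times> carrier L \<subseteq> nabla L a \<squnion>\<^bsub>cong_frame L\<^esub> delta L a"
  proof -
    let ?J = "nabla L a \<squnion>\<^bsub>cong_frame L\<^esub> delta L a"
    have J: "frame_congruence L ?J"
      using C.join_closed[of "nabla L a" "delta L a"] N D by simp
    have "nabla L a \<subseteq> ?J" "delta L a \<subseteq> ?J"
      using C.join_left[of "nabla L a" "delta L a"] C.join_right[of "nabla L a" "delta L a"] N D by simp_all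
    then have "(\<bottom>, \<top>) \<in> ?J"
      by (intro cong_trans[OF J, of \<bottom> a \<top>]) (auto intro: bottom_in_nabla top_in_delta)
    then have "(\<bottom> \<sqinter> x, \<top> \<sqinter> x) \<in> ?J" if "x \<in> carrier L" for x
      using that by (intro cong_meet[OF J] cong_refl[OF J])
    moreover have "\<bottom> \<sqinter> x = \<bottom>" "\<top> \<sqinter> x = x" if "x \<in> carrier L" for x
      using that by (simp_all add: meet_absorb meet_absorb2)
    ultimately have bot: "(\<bottom>, x) \<in> ?J" if "x \<in> carrier L" for x
      using that by metis
    show ?thesis
    proof clarify
      fix x y assume "x \<in> carrier L" "y \<in> carrier L"
      then show "(x, y) \<in> ?J"
        by (intro cong_trans[OF J cong_sym[OF J bot] bot])
    qed
  qed
  then have "nabla L a \<squnion>\<^bsub>cong_frame L\<^esub> delta L a = carrier L \<times> carrier L"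
    using C.top_higher[of "nabla L a \<squnion>\<^bsub>cong_frame L\<^esub> delta L a"] C.join_closed[of "nabla L a" "delta L a"] N D
    by (simp add: cong_frame_top[OF L] subset_antisym)
  ultimately show ?thesis
    by (simp add: is_complement_def N D cong_frame_meet[OF L] cong_frame_top[OF L] cong_frame_bottom[OF L])
qed

lemma unit_map_frame_hom: "unit_map L \<in> frame_hom L (cong_frame L)"
  unfolding frame_hom_def
proof (intro CollectI conjI ballI allI impI)
  show "unit_map L \<in> carrier L \<rightarrow>\<^sub>E carrier (cong_frame L)"
    by (simp add: unit_map_def frame_congruence_nabla)
  have "a \<squnion> b = \<top>" if "a = \<top>" "b \<in> carrier L" for a b
    using that by (simp add: join_absorb2)
  then show "unit_map L \<top> = \<top>\<^bsub>cong_frame L\<^esub>"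
    by (auto simp: unit_map_def nabla_eq cong_frame_top[OF L])
next
  fix a b assume [simp]: "a \<in> carrier L" "b \<in> carrier L"
  have "nabla L a \<inter> nabla L b \<subseteq> nabla L (a \<sqinter> b)"
  proof clarify
    fix x y assume "(x, y) \<in> nabla L a" "(x, y) \<in> nabla L b"
    then have [simp]: "x \<in> carrier L" "y \<in> carrier L"
      and eq: "a \<squnion> x = a \<squnion> y" "b \<squnion> x = b \<squnion> y"
      by (simp_all add: nabla_eq)
    have "z \<squnion> (a \<sqinter> b) = (a \<squnion> z) \<sqinter> (b \<squnion> z)" if "z \<in> carrier L" for z
      using that by (simp add: join_meet_distrib join_commute[of z a] join_commute[of z b])
    from this[of x] this[of y] have "(a \<sqinter> b) \<squnion> x = (a \<sqinter> b) \<squnion> y"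
      by (simp add: join_commute[of "a \<sqinter> b"] eq)
    then show "(x, y) \<in> nabla L (a \<sqinter> b)" by (simp add: nabla_eq)
  qed
  moreover have "nabla L (a \<sqinter> b) \<subseteq> nabla L a \<inter> nabla L b"
    using nabla_mono[of "a \<sqinter> b" a] nabla_mono[of "a \<sqinter> b" b] by (simp add: meet_left meet_right)
  ultimately have "nabla L (a \<sqinter> b) = nabla L a \<inter> nabla L b" by (rule subset_antisym[rotated])
  then show "unit_map L (a \<sqinter> b) = unit_map L a \<sqinter>\<^bsub>cong_frame L\<^esub> unit_map L b"
    by (simp add: unit_map_def cong_frame_meet[OF L] frame_congruence_nabla)
next
  fix S assume S: "S \<subseteq> carrier L"
  have im: "unit_map L ` S = nabla L ` S"
    using S by (intro image_cong) (auto simp: unit_map_def)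
  have "\<Squnion>\<^bsub>cong_frame L\<^esub> (nabla L ` S) = nabla L (\<Squnion>S)"
  proof (rule C.Sup_eqI)
    show "\<theta> \<sqsubseteq>\<^bsub>cong_frame L\<^esub> nabla L (\<Squnion>S)" if "\<theta> \<in> nabla L ` S" for \<theta>
    proof -
      from that obtain a where "a \<in> S" "\<theta> = nabla L a" by auto
      then show ?thesis using nabla_mono[of a "\<Squnion>S"] S by (auto simp: sup_upper)
    qed
    fix \<theta> assume "\<theta> \<in> carrier (cong_frame L)"
      and ub: "\<And>\<psi>. \<psi> \<in> nabla L ` S \<Longrightarrow> \<psi> \<sqsubseteq>\<^bsub>cong_frame L\<^esub> \<theta>"
    then have \<theta>: "frame_congruence L \<theta>" by simp
    have "(\<bottom>, a) \<in> \<theta>" if "a \<in> S" for a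
      using ub[of "nabla L a"] that by (simp add: nabla_le_iff[OF \<theta>])
    then have R: "(\<lambda>a. (\<bottom>, a)) ` S \<subseteq> \<theta>" by auto
    have "\<Squnion>((\<lambda>a. \<bottom>) ` S) = \<bottom>" by (rule Sup_eqI) auto
    then have "(\<bottom>, \<Squnion>S) \<in> \<theta>"
      using cong_Sup[OF \<theta> R] by (simp add: image_image)
    then show "nabla L (\<Squnion>S) \<sqsubseteq>\<^bsub>cong_frame L\<^esub> \<theta>"
      by (simp add: nabla_le_iff[OF \<theta>])
  qed (use S in \<open>auto intro!: frame_congruence_nabla sup_closed\<close>)
  then show "unit_map L (\<Squnion>S) = \<Squnion>\<^bsub>cong_frame L\<^esub> (unit_map L ` S)"
    using S im by (simp add: unit_map_def)
qed

lemma subframe_nabla: "subframe (nabla L ` carrier L) (cong_frame L)"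
proof -
  note u = frame_homD[OF unit_map_frame_hom]
  have u': "unit_map L a = nabla L a" if "a \<in> carrier L" for a
    using that by (simp add: unit_map_def)
  show ?thesis
    unfolding subframe_def
  proof (intro conjI allI impI ballI)
    show "nabla L ` carrier L \<subseteq> carrier (cong_frame L)"
      by (auto simp: frame_congruence_nabla)
    show "\<top>\<^bsub>cong_frame L\<^esub> \<in> nabla L ` carrier L"
      using u(2) u'[of \<top>] by (metis image_eqI top_closed)
    show "\<theta> \<sqinter>\<^bsub>cong_frame L\<^esub> \<psi> \<in> nabla L ` carrier L"
      if \<theta>: "\<theta> \<in> nabla L ` carrier L" and \<psi>: "\<psi> \<in> nabla L ` carrier L" for \<theta> \<psi>
    proof -
      obtain a b where ab: "a \<in> carrier L" "b \<in> carrier L" "\<theta> = nabla L a" "\<psi> = nabla L b"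
        using \<theta> \<psi> by auto
      then have "\<theta> \<sqinter>\<^bsub>cong_frame L\<^esub> \<psi> = nabla L (a \<sqinter> b)"
        using u(3)[of a b] by (simp add: u')
      then show ?thesis using ab by simp
    qed
    fix X assume "X \<subseteq> nabla L ` carrier L"
    then obtain S where S: "S \<subseteq> carrier L" "X = nabla L ` S" by (auto simp: subset_image_iff)
    have "unit_map L ` S = nabla L ` S"
      using S(1) by (intro image_cong) (auto simp: u')
    then have "\<Squnion>\<^bsub>cong_frame L\<^esub> X = nabla L (\<Squnion>S)"
      using u(4)[OF S(1)] S by (simp add: u')
    then show "\<Squnion>\<^bsub>cong_frame L\<^esub> X \<in> nabla L ` carrier L" using S by simp
  qed
qed

text \<open>
  The congruence \<open>\<nabla>\<^sub>b \<sqinter> \<Delta>\<^sub>a\<close> contains \<open>(a, a \<squnion> b)\<close>; together with the mirror image for \<open>(b, a)\<close> this puts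
  \<open>(a, b)\<close> into the join. Conversely, two elements related by it have the same join with \<open>b\<close> and the
  same meet with \<open>a\<close>, so by distributivity they become equal as soon as \<open>a\<close> and \<open>b\<close> are identified.
\<close>

lemma cong_eq_Sup:
  assumes \<theta>: "frame_congruence L \<theta>"
  shows "\<theta> = \<Squnion>\<^bsub>cong_frame L\<^esub> ((\<lambda>(a, b). nabla L b \<inter> delta L a) ` \<theta>)"
proof -
  let ?T = "(\<lambda>(a, b). nabla L b \<inter> delta L a) ` \<theta>"
  have T: "?T \<subseteq> carrier (cong_frame L)"
    using cong_closed[OF \<theta>]
    by (auto intro!: frame_congruence_Int frame_congruence_nabla frame_congruence_delta)
  have "\<Squnion>\<^bsub>cong_frame L\<^esub> ?T = \<theta>"
  proof (rule C.Sup_eqI[OF T])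
    fix \<psi> assume "\<psi> \<in> ?T"
    then obtain a b where ab: "(a, b) \<in> \<theta>" and \<psi>: "\<psi> = nabla L b \<inter> delta L a" by auto
    note [simp] = cong_closed[OF \<theta> ab]
    have "\<psi> \<subseteq> \<theta>"
      unfolding \<psi>
    proof clarify
      fix x y assume "(x, y) \<in> nabla L b" "(x, y) \<in> delta L a"
      then have [simp]: "x \<in> carrier L" "y \<in> carrier L"
        and j: "b \<squnion> x = b \<squnion> y" and m: "a \<sqinter> x = a \<sqinter> y"
        by (simp_all add: nabla_eq delta_eq)
      \<comment> \<open>modulo \<open>\<theta>\<close>, the part of \<open>z\<close> below \<open>b\<close> may be replaced by the part below \<open>a\<close>\<close>
      have shift: "((z \<sqinter> b) \<squnion> (x \<sqinter> y), (a \<sqinter> z) \<squnion> (x \<sqinter> y)) \<in> \<theta>" if "z \<in> carrier L" for z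
        using that cong_meet[OF \<theta> cong_refl[OF \<theta> that] cong_sym[OF \<theta> ab]]
        by (intro cong_join[OF \<theta>] cong_refl[OF \<theta>]) (simp_all add: meet_commute[of a])
      have "x = x \<sqinter> (b \<squnion> y)" by (simp add: meet_absorb join_right flip: j)
      also have "\<dots> = (x \<sqinter> b) \<squnion> (x \<sqinter> y)" by (simp add: meet_join_distrib)
      finally have x: "x = (x \<sqinter> b) \<squnion> (x \<sqinter> y)" .
      have "y = y \<sqinter> (b \<squnion> x)" by (simp add: meet_absorb join_right j)
      also have "\<dots> = (y \<sqinter> b) \<squnion> (x \<sqinter> y)" by (simp add: meet_join_distrib meet_commute[of x])
      finally have y: "y = (y \<sqinter> b) \<squnion> (x \<sqinter> y)" .
      show "(x, y) \<in> \<theta>"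
        using cong_trans[OF \<theta> shift[of x] cong_sym[OF \<theta> shift[of y, folded m]]]
        by (simp flip: x y)
    qed
    then show "\<psi> \<sqsubseteq>\<^bsub>cong_frame L\<^esub> \<theta>" by simp
  next
    fix \<phi> assume "\<phi> \<in> carrier (cong_frame L)" and ub: "\<And>\<psi>. \<psi> \<in> ?T \<Longrightarrow> \<psi> \<sqsubseteq>\<^bsub>cong_frame L\<^esub> \<phi>"
    then have \<phi>: "frame_congruence L \<phi>" by simp
    have step: "(a, a \<squnion> b) \<in> \<phi>" if ab: "(a, b) \<in> \<theta>" for a b
    proof -
      note [simp] = cong_closed[OF \<theta> ab]
      have "b \<squnion> (a \<squnion> b) = b \<squnion> a"
        by (simp add: join_absorb join_right join_commute[of b a])
      moreover have "a \<sqinter> (a \<squnion> b) = a \<sqinter> a"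
        by (simp add: meet_absorb join_left)
      ultimately have "(a, a \<squnion> b) \<in> nabla L b \<inter> delta L a"
        by (simp add: nabla_eq delta_eq)
      then show ?thesis using ub[of "nabla L b \<inter> delta L a"] ab by auto
    qed
    have "\<theta> \<subseteq> \<phi>"
    proof clarify
      fix a b assume ab: "(a, b) \<in> \<theta>"
      have "(a, a \<squnion> b) \<in> \<phi>" "(b, a \<squnion> b) \<in> \<phi>"
        using step[OF ab] step[OF cong_sym[OF \<theta> ab]] by (simp_all add: join_commute[of b])
      then show "(a, b) \<in> \<phi>" by (blast intro: cong_sym[OF \<phi>] cong_trans[OF \<phi>])
    qed
    then show "\<theta> \<sqsubseteq>\<^bsub>cong_frame L\<^esub> \<phi>" by simp
  qed (use \<theta> in simp)
  then show ?thesis by simp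
qed

lemma cong_biframe_strictly_zero_dimensional: "strictly_zero_dimensional (cong_biframe L)"
proof -
  let ?C = "cong_frame L" and ?N = "nabla L ` carrier L"
  let ?D = "generated_subframe ?C (delta L ` carrier L)"
  have delta: "delta L ` carrier L \<subseteq> carrier ?C"
    by (auto simp: frame_congruence_delta)
  note D = subframe_generated[OF cong_frame_frame[OF L] delta]
  have ND: "?N \<union> ?D \<subseteq> carrier ?C"
    using subframe_nabla D by (simp add: subframe_def)
  let ?G = "generated_subframe ?C (?N \<union> ?D)"
  note G = subframe_generated[OF cong_frame_frame[OF L] ND]
  have mem: "nabla L a \<in> ?G" "delta L a \<in> ?G" if "a \<in> carrier L" for a
    using that generated_subframe_superset[of "?N \<union> ?D" ?C]
      generated_subframe_superset[of "delta L ` carrier L" ?C] by auto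
  have "\<theta> \<in> ?G" if "frame_congruence L \<theta>" for \<theta>
  proof -
    have "nabla L b \<inter> delta L a \<in> ?G" if "(a, b) \<in> \<theta>" for a b
    proof -
      have ab: "a \<in> carrier L" "b \<in> carrier L"
        using cong_closed[OF \<open>frame_congruence L \<theta>\<close> that] by simp_all
      then have "nabla L b \<sqinter>\<^bsub>?C\<^esub> delta L a \<in> ?G"
        using G mem by (simp add: subframe_def)
      then show ?thesis
        by (simp add: cong_frame_meet[OF L frame_congruence_nabla[OF ab(2)] frame_congruence_delta[OF ab(1)]])
    qed
    then have "(\<lambda>(a, b). nabla L b \<inter> delta L a) ` \<theta> \<subseteq> ?G" by auto
    from subframe_Sup_closed[OF G this] show ?thesis
      by (simp flip: cong_eq_Sup[OF that])
  qed
  then have "?G = carrier ?C"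
    using G by (auto simp: subframe_def)
  then have biframe: "is_biframe (cong_biframe L)"
    using D subframe_nabla by (simp add: is_biframe_def cong_biframe_def cong_frame_frame[OF L])
  have "{b. \<exists>a\<in>?N. is_complement ?C a b} = delta L ` carrier L"
  proof (intro equalityI subsetI)
    fix \<theta> assume "\<theta> \<in> {b. \<exists>a\<in>?N. is_complement ?C a b}"
    then obtain a where a: "a \<in> carrier L" "is_complement ?C (nabla L a) \<theta>" by auto
    then have "\<theta> = delta L a"
      using complement_unique[OF cong_frame_frame[OF L] _ nabla_delta_complement] by blast
    then show "\<theta> \<in> delta L ` carrier L" using a by simp
  qed (use nabla_delta_complement in blast)
  moreover have "\<exists>b\<in>?D. is_complement ?C \<theta> b" if "\<theta> \<in> ?N" for \<theta>
    using that nabla_delta_complement generated_subframe_superset[of "delta L ` carrier L" ?C] by auto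
  ultimately show ?thesis
    using biframe by (simp add: strictly_zero_dimensional_def cong_biframe_def)
qed

end

section \<open>Strictly zero-dimensional biframes\<close>

lemma strictly_zero_dimensionalD:
  assumes "strictly_zero_dimensional M"
  shows "is_biframe M" "frame (total_part M)"
    "subframe (first_part M) (total_part M)" "subframe (second_part M) (total_part M)"
    "generated_subframe (total_part M) (first_part M \<union> second_part M) = carrier (total_part M)"
    "generated_subframe (total_part M)
       {b. \<exists>a\<in>first_part M. is_complement (total_part M) a b} = second_part M"
    "a \<in> first_part M \<Longrightarrow> \<exists>b\<in>second_part M. is_complement (total_part M) a b"
  using assms by (auto simp: strictly_zero_dimensional_def is_biframe_def)

lemma complement_in_second_part:
  assumes M: "strictly_zero_dimensional M" and "a \<in> first_part M" "is_complement (total_part M) a b"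
  shows "b \<in> second_part M"
  using strictly_zero_dimensionalD(7)[OF M assms(2)]
    complement_unique[OF strictly_zero_dimensionalD(2)[OF M] assms(3)] by auto

lemma second_part_subset:
  assumes M: "strictly_zero_dimensional M" and S: "subframe S (total_part M)"
    and compl: "\<And>a b. \<lbrakk>a \<in> first_part M; is_complement (total_part M) a b\<rbrakk> \<Longrightarrow> b \<in> S"
  shows "second_part M \<subseteq> S"
  using generated_subframe_least[OF S, of "{b. \<exists>a\<in>first_part M. is_complement (total_part M) a b}"]
    compl strictly_zero_dimensionalD(6)[OF M] by auto

text \<open>
  The condition on second parts is automatic: the preimage of the second part is a subframe that
  contains the complements of the elements of the first part.
\<close>

lemma biframe_homI:
  assumes M: "strictly_zero_dimensional M" and N: "strictly_zero_dimensional N"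
    and g: "g \<in> frame_hom (total_part M) (total_part N)"
    and first: "g ` first_part M \<subseteq> first_part N"
  shows "g \<in> biframe_hom M N"
proof -
  note FM = strictly_zero_dimensionalD(2)[OF M] and FN = strictly_zero_dimensionalD(2)[OF N]
  have "second_part M \<subseteq> {x \<in> carrier (total_part M). g x \<in> second_part N}"
  proof (rule second_part_subset[OF M])
    show "subframe {x \<in> carrier (total_part M). g x \<in> second_part N} (total_part M)"
      by (rule subframe_vimage[OF FM FN g strictly_zero_dimensionalD(4)[OF N]])
    fix a b assume a: "a \<in> first_part M" and ab: "is_complement (total_part M) a b"
    have "g b \<in> second_part N"
      using complement_in_second_part[OF N _ frame_hom_complement[OF FM FN g ab]] a first by auto
    then show "b \<in> {x \<in> carrier (total_part M). g x \<in> second_part N}"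
      using ab by (simp add: is_complement_def)
  qed
  then show ?thesis using g first by (auto simp: biframe_hom_def)
qed

text \<open>
  The equalizer is a subframe, and it contains the complements of the elements of the first part
  since these are unique in the codomain.
\<close>

lemma frame_hom_eq_if_eq_on_first_part:
  assumes M: "strictly_zero_dimensional M" and N: "frame N"
    and g: "g \<in> frame_hom (total_part M) N" and h: "h \<in> frame_hom (total_part M) N"
    and eq: "\<And>a. a \<in> first_part M \<Longrightarrow> g a = h a"
  shows "g = h"
proof -
  note FM = strictly_zero_dimensionalD(2)[OF M]
  let ?E = "{x \<in> carrier (total_part M). g x = h x}"
  have E: "subframe ?E (total_part M)" by (rule subframe_equalizer[OF FM N g h])
  have first: "first_part M \<subseteq> ?E"
    using strictly_zero_dimensionalD(3)[OF M] eq by (auto simp: subframe_def)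
  moreover have "second_part M \<subseteq> ?E"
  proof (rule second_part_subset[OF M E])
    fix a b assume a: "a \<in> first_part M" and ab: "is_complement (total_part M) a b"
    have "is_complement N (g a) (h b)"
      using frame_hom_complement[OF FM N h ab] eq[OF a] by simp
    then have "g b = h b"
      using complement_unique[OF N frame_hom_complement[OF FM N g ab]] by simp
    then show "b \<in> ?E" using ab by (simp add: is_complement_def)
  qed
  ultimately have "carrier (total_part M) \<subseteq> ?E"
    using generated_subframe_least[OF E, of "first_part M \<union> second_part M"]
      strictly_zero_dimensionalD(5)[OF M] by auto
  then have "g x = h x" if "x \<in> carrier (total_part M)" for x using that by auto
  moreover have "g \<in> extensional (carrier (total_part M))" "h \<in> extensional (carrier (total_part M))"
    using g h by (auto simp: frame_hom_def PiE_def)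
  ultimately show ?thesis by (intro extensionalityI) auto
qed

lemma first_frame_frame: "strictly_zero_dimensional M \<Longrightarrow> frame (first_frame M)"
  unfolding first_frame_def
  by (rule subframe_frame) (auto dest: strictly_zero_dimensionalD)

lemma frame_hom_first_frame_iff:
  assumes "strictly_zero_dimensional M"
  shows "f \<in> frame_hom K (first_frame M) \<longleftrightarrow>
    f \<in> frame_hom K (total_part M) \<and> f ` carrier K \<subseteq> first_part M"
  unfolding first_frame_def
  using strictly_zero_dimensionalD(2,3)[OF assms] by (rule frame_hom_into_subframe)

lemma first_map_frame_hom:
  assumes M: "strictly_zero_dimensional M" and N: "strictly_zero_dimensional N"
    and g: "g \<in> biframe_hom M N"
  shows "first_map M g \<in> frame_hom (first_frame M) (first_frame N)"
proof -
  have "first_map M g \<in> frame_hom (first_frame M) (total_part N)"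
    unfolding first_map_def first_frame_def
    using strictly_zero_dimensionalD(2,3)[OF M] g
    by (intro frame_hom_restrict) (auto simp: biframe_hom_def)
  moreover have "first_map M g ` carrier (first_frame M) \<subseteq> first_part N"
    using g by (auto simp: biframe_hom_def first_map_def first_frame_def)
  ultimately show ?thesis
    by (simp add: frame_hom_first_frame_iff[OF N])
qed

section \<open>The universal property of the congruence frame\<close>

text \<open>
  In the proof, \<open>k\<close> chooses complements, \<open>v (a, b)\<close> is the contribution of a pair to the join that
  defines \<open>g\<close>, and \<open>r\<close> is the right adjoint of \<open>g\<close>: indeed \<open>v (a, b)\<close> is below \<open>n\<close> iff \<open>f b\<close> is below
  \<open>n \<squnion> f a\<close>, and by symmetry of \<open>\<theta>\<close> this holds for all pairs iff \<open>n \<squnion> f a = n \<squnion> f b\<close> for all of them.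
\<close>

lemma cong_frame_extension:
  fixes L :: "'a gorder" and N :: "'b gorder"
  assumes L: "frame L" and N: "frame N" and f: "f \<in> frame_hom L N"
    and compl: "\<And>a. a \<in> carrier L \<Longrightarrow> \<exists>c. is_complement N (f a) c"
  obtains g where "g \<in> frame_hom (cong_frame L) N" "\<And>a. a \<in> carrier L \<Longrightarrow> g (nabla L a) = f a"
proof -
  interpret L: frame L by (rule L)
  interpret N: frame N by (rule N)
  interpret C: frame "cong_frame L" by (rule cong_frame_frame[OF L])
  note f_closed [simp] = frame_hom_closed[OF L N f]
  define k where "k a = (SOME c. is_complement N (f a) c)" for a
  have k: "is_complement N (f a) (k a)" if "a \<in> carrier L" for a
    unfolding k_def using compl[OF that] by (rule someI_ex)
  then have k_closed [simp]: "k a \<in> carrier N" if "a \<in> carrier L" for a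
    using that by (simp add: is_complement_def)
  define v where "v = (\<lambda>(a, b). f b \<sqinter>\<^bsub>N\<^esub> k a)"
  define g where "g = (\<lambda>\<theta>\<in>carrier (cong_frame L). \<Squnion>\<^bsub>N\<^esub> (v ` \<theta>))"
  define r where
    "r n = {(x, y). x \<in> carrier L \<and> y \<in> carrier L \<and> n \<squnion>\<^bsub>N\<^esub> f x = n \<squnion>\<^bsub>N\<^esub> f y}" for n
  have r: "frame_congruence L (r n)" if "n \<in> carrier N" for n
    unfolding r_def by (rule frame_congruence_kernel_join[OF L N f that])
  have v: "v ` \<theta> \<subseteq> carrier N" if "frame_congruence L \<theta>" for \<theta>
    using cong_closed[OF that] by (auto simp: v_def)
  have g_closed: "g \<theta> \<in> carrier N" if "frame_congruence L \<theta>" for \<theta>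
    using that v[OF that] by (simp add: g_def)
  have v_le: "v (a, b) \<sqsubseteq>\<^bsub>N\<^esub> n \<longleftrightarrow> f b \<sqsubseteq>\<^bsub>N\<^esub> n \<squnion>\<^bsub>N\<^esub> f a"
    if "a \<in> carrier L" "b \<in> carrier L" "n \<in> carrier N" for a b n
    using that meet_complement_le_iff[OF N k, of a "f b" n] by (simp add: v_def N.join_commute[of n])
  have adj: "g \<theta> \<sqsubseteq>\<^bsub>N\<^esub> n \<longleftrightarrow> \<theta> \<subseteq> r n" if \<theta>: "frame_congruence L \<theta>" and n: "n \<in> carrier N" for \<theta> n
  proof -
    have le: "f b \<sqsubseteq>\<^bsub>N\<^esub> n \<squnion>\<^bsub>N\<^esub> f a \<longleftrightarrow> n \<squnion>\<^bsub>N\<^esub> f b \<sqsubseteq>\<^bsub>N\<^esub> n \<squnion>\<^bsub>N\<^esub> f a"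
      if "a \<in> carrier L" "b \<in> carrier L" for a b
      using that n by (simp add: N.join_le_iff N.join_left)
    have "g \<theta> \<sqsubseteq>\<^bsub>N\<^esub> n \<longleftrightarrow> (\<forall>(a, b)\<in>\<theta>. n \<squnion>\<^bsub>N\<^esub> f b \<sqsubseteq>\<^bsub>N\<^esub> n \<squnion>\<^bsub>N\<^esub> f a)"
      using \<theta> n v[OF \<theta>] cong_closed[OF \<theta>] by (auto simp: g_def N.Sup_le_iff v_le le)
    also have "\<dots> \<longleftrightarrow> \<theta> \<subseteq> r n"
    proof
      assume *: "\<forall>(a, b)\<in>\<theta>. n \<squnion>\<^bsub>N\<^esub> f b \<sqsubseteq>\<^bsub>N\<^esub> n \<squnion>\<^bsub>N\<^esub> f a"
      show "\<theta> \<subseteq> r n"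
      proof clarify
        fix a b assume ab: "(a, b) \<in> \<theta>"
        have "n \<squnion>\<^bsub>N\<^esub> f a = n \<squnion>\<^bsub>N\<^esub> f b"
          using * ab cong_sym[OF \<theta> ab] cong_closed[OF \<theta> ab] n by (intro N.le_antisym) auto
        then show "(a, b) \<in> r n" using cong_closed[OF \<theta> ab] by (simp add: r_def)
      qed
    next
      assume "\<theta> \<subseteq> r n"
      then show "\<forall>(a, b)\<in>\<theta>. n \<squnion>\<^bsub>N\<^esub> f b \<sqsubseteq>\<^bsub>N\<^esub> n \<squnion>\<^bsub>N\<^esub> f a"
        using n by (auto simp: r_def subset_iff)
    qed
    finally show ?thesis .
  qed
  have v_le_g: "v (a, b) \<sqsubseteq>\<^bsub>N\<^esub> g \<theta>" if "frame_congruence L \<theta>" "(a, b) \<in> \<theta>" for a b \<theta>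
    using that v[OF that(1)] by (auto simp: g_def intro!: N.sup_upper)
  have g_nabla: "g (nabla L a) = f a" if a [simp]: "a \<in> carrier L" for a
  proof (rule N.le_antisym)
    note \<theta> = frame_congruence_nabla[OF L a]
    have "(\<bottom>\<^bsub>L\<^esub>, a) \<in> r (f a)"
      by (simp add: r_def frame_hom_bottom[OF L N f] N.join_absorb N.join_absorb2)
    then show "g (nabla L a) \<sqsubseteq>\<^bsub>N\<^esub> f a"
      by (simp add: adj[OF \<theta>] nabla_le_iff[OF L r])
    have "f a \<sqsubseteq>\<^bsub>N\<^esub> g (nabla L a) \<squnion>\<^bsub>N\<^esub> f \<bottom>\<^bsub>L\<^esub>"
      using v_le_g[OF \<theta> bottom_in_nabla[OF L]] g_closed[OF \<theta>] by (simp add: v_le)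
    then show "f a \<sqsubseteq>\<^bsub>N\<^esub> g (nabla L a)"
      using g_closed[OF \<theta>] by (simp add: frame_hom_bottom[OF L N f] N.join_absorb2)
    show "g (nabla L a) \<in> carrier N" by (rule g_closed[OF \<theta>])
  qed simp
  have g_top: "g \<top>\<^bsub>cong_frame L\<^esub> = \<top>\<^bsub>N\<^esub>"
  proof -
    have "nabla L \<top>\<^bsub>L\<^esub> = \<top>\<^bsub>cong_frame L\<^esub>"
      using frame_homD(2)[OF unit_map_frame_hom[OF L]] by (simp add: unit_map_def)
    then show ?thesis using g_nabla[of "\<top>\<^bsub>L\<^esub>"] by (simp add: frame_homD(2)[OF f])
  qed
  have g_mono: "g \<theta> \<sqsubseteq>\<^bsub>N\<^esub> g \<psi>"
    if \<theta>: "frame_congruence L \<theta>" and \<psi>: "frame_congruence L \<psi>" and "\<theta> \<subseteq> \<psi>" for \<theta> \<psi>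
  proof -
    have "\<psi> \<subseteq> r (g \<psi>)" using adj[OF \<psi> g_closed[OF \<psi>]] g_closed[OF \<psi>] by simp
    then show ?thesis using that(3) by (simp add: adj[OF \<theta> g_closed[OF \<psi>]])
  qed
  have g_Sup: "g (\<Squnion>\<^bsub>cong_frame L\<^esub> T) = \<Squnion>\<^bsub>N\<^esub> (g ` T)" if T: "T \<subseteq> carrier (cong_frame L)" for T
  proof (rule N.Sup_eqI[symmetric])
    have S: "frame_congruence L (\<Squnion>\<^bsub>cong_frame L\<^esub> T)" using C.sup_closed[OF T] by simp
    show "g ` T \<subseteq> carrier N" using T g_closed by auto
    show "g (\<Squnion>\<^bsub>cong_frame L\<^esub> T) \<in> carrier N" by (rule g_closed[OF S])
    show "n \<sqsubseteq>\<^bsub>N\<^esub> g (\<Squnion>\<^bsub>cong_frame L\<^esub> T)" if "n \<in> g ` T" for n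
      using that T S C.sup_upper[OF T] by (auto intro!: g_mono)
    fix n assume n: "n \<in> carrier N" and ub: "\<And>m. m \<in> g ` T \<Longrightarrow> m \<sqsubseteq>\<^bsub>N\<^esub> n"
    have "\<theta> \<subseteq> r n" if "\<theta> \<in> T" for \<theta>
      using ub[of "g \<theta>"] that T adj[of \<theta> n] n by auto
    then have "\<Squnion>\<^bsub>cong_frame L\<^esub> T \<subseteq> r n"
      using C.Sup_le_iff[OF T, of "r n"] r[OF n] by simp
    then show "g (\<Squnion>\<^bsub>cong_frame L\<^esub> T) \<sqsubseteq>\<^bsub>N\<^esub> n" by (simp add: adj[OF S n])
  qed
  have g_meet: "g (\<theta> \<sqinter>\<^bsub>cong_frame L\<^esub> \<psi>) = g \<theta> \<sqinter>\<^bsub>N\<^esub> g \<psi>"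
    if \<theta>: "frame_congruence L \<theta>" and \<psi>: "frame_congruence L \<psi>" for \<theta> \<psi>
  proof -
    note I = frame_congruence_Int[OF \<theta> \<psi>]
    note [simp] = g_closed[OF \<theta>] g_closed[OF \<psi>] g_closed[OF I]
    have vv: "v (a, b) \<sqinter>\<^bsub>N\<^esub> v (c, d) \<sqsubseteq>\<^bsub>N\<^esub> g (\<theta> \<inter> \<psi>)" if ab: "(a, b) \<in> \<theta>" and cd: "(c, d) \<in> \<psi>" for a b c d
    proof -
      note [simp] = cong_closed[OF \<theta> ab] cong_closed[OF \<psi> cd]
      \<comment> \<open>Modulo \<open>\<theta>\<close>, replacing \<open>a\<close> by \<open>b\<close> turns \<open>a \<squnion> c\<close> into an element above \<open>b \<sqinter> d\<close>, and modulo \<open>\<psi>\<close>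
        so does replacing \<open>c\<close> by \<open>d\<close>; hence \<open>(?x, ?y)\<close> belongs to both congruences.\<close>
      let ?y = "b \<sqinter>\<^bsub>L\<^esub> d" and ?x = "(b \<sqinter>\<^bsub>L\<^esub> d) \<sqinter>\<^bsub>L\<^esub> (a \<squnion>\<^bsub>L\<^esub> c)"
      let ?w = "v (a, b) \<sqinter>\<^bsub>N\<^esub> v (c, d)"
      have w [simp]: "?w \<in> carrier N" by (simp add: v_def)
      have yb: "?y \<sqinter>\<^bsub>L\<^esub> (b \<squnion>\<^bsub>L\<^esub> c) = ?y" "?y \<sqinter>\<^bsub>L\<^esub> (a \<squnion>\<^bsub>L\<^esub> d) = ?y"
        by (auto intro!: L.meet_absorb intro: L.le_trans[OF L.meet_left L.join_left]
            L.le_trans[OF L.meet_right L.join_right])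
      have "(?y \<sqinter>\<^bsub>L\<^esub> (a \<squnion>\<^bsub>L\<^esub> c), ?y \<sqinter>\<^bsub>L\<^esub> (b \<squnion>\<^bsub>L\<^esub> c)) \<in> \<theta>"
        by (intro cong_meet[OF \<theta>] cong_join[OF \<theta>] cong_refl[OF \<theta>] ab) simp_all
      moreover have "(?y \<sqinter>\<^bsub>L\<^esub> (a \<squnion>\<^bsub>L\<^esub> c), ?y \<sqinter>\<^bsub>L\<^esub> (a \<squnion>\<^bsub>L\<^esub> d)) \<in> \<psi>"
        by (intro cong_meet[OF \<psi>] cong_join[OF \<psi>] cong_refl[OF \<psi>] cd) simp_all
      ultimately have xy: "(?x, ?y) \<in> \<theta> \<inter> \<psi>" by (simp add: yb)
      have fy: "?w \<sqsubseteq>\<^bsub>N\<^esub> f ?y"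
        by (auto simp: v_def frame_homD(3)[OF f] N.le_meet_iff
            intro: N.le_trans[OF N.meet_left N.meet_left] N.le_trans[OF N.meet_right N.meet_left])
      have ka: "?w \<sqsubseteq>\<^bsub>N\<^esub> k a" and kc: "?w \<sqsubseteq>\<^bsub>N\<^esub> k c"
        by (auto simp: v_def intro: N.le_trans[OF N.meet_left N.meet_right] N.le_trans[OF N.meet_right N.meet_right])
      let ?n = "g (\<theta> \<inter> \<psi>)"
      \<comment> \<open>\<open>?w\<close> is below \<open>?n \<squnion> f a \<squnion> f c\<close>, and being below \<open>k a\<close> and \<open>k c\<close> it avoids the last two.\<close>
      have "f ?y \<sqsubseteq>\<^bsub>N\<^esub> ?n \<squnion>\<^bsub>N\<^esub> f ?x"
        using v_le_g[OF I xy] by (simp add: v_le)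
      moreover have "f ?x \<sqsubseteq>\<^bsub>N\<^esub> f a \<squnion>\<^bsub>N\<^esub> f c"
        by (simp add: frame_homD(3)[OF f] frame_hom_join[OF L N f] N.meet_right)
      then have "?n \<squnion>\<^bsub>N\<^esub> f ?x \<sqsubseteq>\<^bsub>N\<^esub> f a \<squnion>\<^bsub>N\<^esub> (f c \<squnion>\<^bsub>N\<^esub> ?n)"
        by (auto simp: N.join_le_iff N.join_right N.join_assoc[symmetric]
            intro: N.le_trans[OF _ N.join_left])
      ultimately have "f ?y \<sqsubseteq>\<^bsub>N\<^esub> f a \<squnion>\<^bsub>N\<^esub> (f c \<squnion>\<^bsub>N\<^esub> ?n)"
        by (rule N.le_trans) simp_all
      with fy have "?w \<sqsubseteq>\<^bsub>N\<^esub> f a \<squnion>\<^bsub>N\<^esub> (f c \<squnion>\<^bsub>N\<^esub> ?n)"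
        by (rule N.le_trans) simp_all
      then have "?w \<sqinter>\<^bsub>N\<^esub> k a \<sqsubseteq>\<^bsub>N\<^esub> f c \<squnion>\<^bsub>N\<^esub> ?n"
        by (simp add: meet_complement_le_iff[OF N k])
      then have "?w \<sqinter>\<^bsub>N\<^esub> k c \<sqsubseteq>\<^bsub>N\<^esub> ?n"
        by (simp add: N.meet_absorb[OF _ _ ka] meet_complement_le_iff[OF N k])
      then show ?thesis
        by (simp add: N.meet_absorb[OF _ _ kc])
    qed
    have "g \<theta> \<sqinter>\<^bsub>N\<^esub> g \<psi> \<sqsubseteq>\<^bsub>N\<^esub> g (\<theta> \<inter> \<psi>)"
    proof -
      have "\<Squnion>\<^bsub>N\<^esub> (v ` \<theta>) \<sqinter>\<^bsub>N\<^esub> \<Squnion>\<^bsub>N\<^esub> (v ` \<psi>) \<sqsubseteq>\<^bsub>N\<^esub> g (\<theta> \<inter> \<psi>)"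
        using vv by (intro N.meet_Sup_Sup_le v \<theta> \<psi>) auto
      then show ?thesis using \<theta> \<psi> by (simp add: g_def)
    qed
    moreover have "g (\<theta> \<inter> \<psi>) \<sqsubseteq>\<^bsub>N\<^esub> g \<theta> \<sqinter>\<^bsub>N\<^esub> g \<psi>"
      using g_mono[OF I \<theta>] g_mono[OF I \<psi>] by (simp add: N.le_meet_iff)
    ultimately show ?thesis
      by (simp add: cong_frame_meet[OF L \<theta> \<psi>] N.le_antisym)
  qed
  have "g \<in> frame_hom (cong_frame L) N"
    unfolding frame_hom_def
    using g_closed g_top g_Sup g_meet by (auto simp: g_def PiE_def)
  then show thesis using g_nabla that by blast
qed

section \<open>The adjunction\<close>

lemma cong_biframe_simps [simp]:
  "total_part (cong_biframe L) = cong_frame L"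
  "first_part (cong_biframe L) = nabla L ` carrier L"
  by (simp_all add: cong_biframe_def)

lemma first_frame_carrier [simp]: "carrier (first_frame M) = first_part M"
  by (simp add: first_frame_def)

lemma hom_transpose_apply: "a \<in> carrier L \<Longrightarrow> hom_transpose L g a = g (nabla L a)"
  by (simp add: hom_transpose_def compose_eq first_map_def unit_map_def)

lemma unit_map_first_frame_hom:
  "frame L \<Longrightarrow> unit_map L \<in> frame_hom L (first_frame (cong_biframe L))"
  by (simp add: frame_hom_first_frame_iff cong_biframe_strictly_zero_dimensional unit_map_frame_hom)
    (auto simp: unit_map_def)

lemma hom_transpose_frame_hom:
  assumes L: "frame L" and M: "strictly_zero_dimensional M" and g: "g \<in> biframe_hom (cong_biframe L) M"
  shows "hom_transpose L g \<in> frame_hom L (first_frame M)"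
  unfolding hom_transpose_def
  using L unit_map_first_frame_hom[OF L]
    first_map_frame_hom[OF cong_biframe_strictly_zero_dimensional[OF L] M g]
  by (rule compose_frame_hom)

text \<open>
  Values in the first part of \<open>M\<close> are complemented, which is all that the extension needs.
\<close>

lemma biframe_extension:
  assumes L: "frame L" and M: "strictly_zero_dimensional M" and f: "f \<in> frame_hom L (first_frame M)"
  obtains g where "g \<in> biframe_hom (cong_biframe L) M" "\<And>a. a \<in> carrier L \<Longrightarrow> g (nabla L a) = f a"
proof -
  have f': "f \<in> frame_hom L (total_part M)" and first: "f ` carrier L \<subseteq> first_part M"
    using f by (simp_all add: frame_hom_first_frame_iff[OF M])
  have "\<exists>c. is_complement (total_part M) (f a) c" if "a \<in> carrier L" for a
    using strictly_zero_dimensionalD(7)[OF M, of "f a"] first that by auto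
  then obtain g where g: "g \<in> frame_hom (cong_frame L) (total_part M)"
    and nabla: "\<And>a. a \<in> carrier L \<Longrightarrow> g (nabla L a) = f a"
    using cong_frame_extension[OF L strictly_zero_dimensionalD(2)[OF M] f'] by blast
  have "g \<in> biframe_hom (cong_biframe L) M"
    using g nabla first by (intro biframe_homI cong_biframe_strictly_zero_dimensional L M) auto
  then show thesis using nabla by (rule that)
qed

lemma cong_frame_hom_eqI:
  assumes "frame L" "frame N" "g \<in> frame_hom (cong_frame L) N" "h \<in> frame_hom (cong_frame L) N"
    and "\<And>a. a \<in> carrier L \<Longrightarrow> g (nabla L a) = h (nabla L a)"
  shows "g = h"
  using assms
  by (intro frame_hom_eq_if_eq_on_first_part[OF cong_biframe_strictly_zero_dimensional[of L]]) auto

lemma hom_transpose_bij: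
  assumes L: "frame L" and M: "strictly_zero_dimensional M"
  shows "bij_betw (hom_transpose L) (biframe_hom (cong_biframe L) M) (frame_hom L (first_frame M))"
  unfolding bij_betw_def
proof (intro conjI inj_onI equalityI subsetI)
  fix g h assume "g \<in> biframe_hom (cong_biframe L) M" "h \<in> biframe_hom (cong_biframe L) M"
    and eq: "hom_transpose L g = hom_transpose L h"
  then have "g \<in> frame_hom (cong_frame L) (total_part M)" "h \<in> frame_hom (cong_frame L) (total_part M)"
    by (simp_all add: biframe_hom_def)
  moreover have "g (nabla L a) = h (nabla L a)" if "a \<in> carrier L" for a
    using fun_cong[OF eq, of a] that by (simp add: hom_transpose_apply)
  ultimately show "g = h"
    by (rule cong_frame_hom_eqI[OF L strictly_zero_dimensionalD(2)[OF M]])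
next
  fix f assume f: "f \<in> frame_hom L (first_frame M)"
  obtain g where g: "g \<in> biframe_hom (cong_biframe L) M"
    and nabla: "\<And>a. a \<in> carrier L \<Longrightarrow> g (nabla L a) = f a"
    using biframe_extension[OF L M f] by blast
  have "f \<in> extensional (carrier L)"
    using f by (auto simp: frame_hom_def PiE_def)
  moreover have "hom_transpose L g \<in> extensional (carrier L)"
    by (simp add: hom_transpose_def compose_def)
  ultimately have "f = hom_transpose L g"
    by (rule extensionalityI) (simp add: hom_transpose_apply nabla)
  then show "f \<in> hom_transpose L ` biframe_hom (cong_biframe L) M" using g by auto
qed (auto intro: hom_transpose_frame_hom[OF L M])

lemma cong_map_well_defined:
  assumes L: "frame L" and M: "frame M" and f: "f \<in> frame_hom L M"
  shows cong_map_ex1: "\<exists>!g. is_cong_map L M f g"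
    and cong_map_biframe_hom: "cong_map L M f \<in> biframe_hom (cong_biframe L) (cong_biframe M)"
proof -
  have "compose (carrier L) (unit_map M) f \<in> frame_hom L (first_frame (cong_biframe M))"
    by (rule compose_frame_hom[OF L f unit_map_first_frame_hom[OF M]])
  then obtain g where g: "g \<in> biframe_hom (cong_biframe L) (cong_biframe M)"
    and nabla: "\<And>a. a \<in> carrier L \<Longrightarrow> g (nabla L a) = compose (carrier L) (unit_map M) f a"
    using biframe_extension[OF L cong_biframe_strictly_zero_dimensional[OF M]] by blast
  have map: "is_cong_map L M f g"
    using g nabla frame_hom_closed[OF L M f]
    by (simp add: is_cong_map_def biframe_hom_def compose_eq unit_map_def)
  have unique: "h = g" if "is_cong_map L M f h" for h
    using that map by (intro cong_frame_hom_eqI[OF L cong_frame_frame[OF M]]) (auto simp: is_cong_map_def)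
  show "\<exists>!g. is_cong_map L M f g" using map unique by blast
  have "cong_map L M f = g"
    unfolding cong_map_def using map unique by (rule the_equality)
  then show "cong_map L M f \<in> biframe_hom (cong_biframe L) (cong_biframe M)" using g by simp
qed

lemma cong_map_is_cong_map:
  "\<lbrakk>frame L; frame M; f \<in> frame_hom L M\<rbrakk> \<Longrightarrow> is_cong_map L M f (cong_map L M f)"
  unfolding cong_map_def by (rule theI'[OF cong_map_ex1])

lemma cong_map_nabla:
  assumes "frame L" "frame M" "f \<in> frame_hom L M" "a \<in> carrier L"
  shows "cong_map L M f (nabla L a) = nabla M (f a)"
  using cong_map_is_cong_map[OF assms(1-3)] assms(4) by (simp add: is_cong_map_def)

lemma cong_map_eqI:
  "\<lbrakk>frame L; frame M; f \<in> frame_hom L M; is_cong_map L M f g\<rbrakk> \<Longrightarrow> cong_map L M f = g"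
  unfolding cong_map_def by (rule the1_equality[OF cong_map_ex1])

lemma cong_map_id:
  assumes "frame L"
  shows "cong_map L L (\<lambda>x\<in>carrier L. x) = (\<lambda>\<theta>\<in>carrier (cong_frame L). \<theta>)"
  using assms id_frame_hom[OF cong_frame_frame[OF assms]]
  by (intro cong_map_eqI id_frame_hom) (simp_all add: is_cong_map_def frame_congruence_nabla)

lemma cong_map_compose:
  assumes L: "frame L" and M: "frame M" and N: "frame N"
    and f: "f \<in> frame_hom L M" and h: "h \<in> frame_hom M N"
  shows "cong_map L N (compose (carrier L) h f) =
    compose (carrier (cong_frame L)) (cong_map M N h) (cong_map L M f)"
proof (rule cong_map_eqI[OF L N compose_frame_hom[OF L f h]])
  have "compose (carrier (cong_frame L)) (cong_map M N h) (cong_map L M f)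
      \<in> frame_hom (cong_frame L) (cong_frame N)"
    using cong_map_is_cong_map[OF L M f] cong_map_is_cong_map[OF M N h]
    by (intro compose_frame_hom[OF cong_frame_frame[OF L]]) (auto simp: is_cong_map_def)
  then show "is_cong_map L N (compose (carrier L) h f)
      (compose (carrier (cong_frame L)) (cong_map M N h) (cong_map L M f))"
    using L M N f h frame_hom_closed[OF L M f]
    by (simp add: is_cong_map_def compose_eq frame_congruence_nabla cong_map_nabla)
qed

lemma first_map_compose:
  assumes M: "strictly_zero_dimensional M" and g: "g \<in> biframe_hom M M'"
  shows "first_map M (compose (carrier (total_part M)) g' g) =
    compose (carrier (first_frame M)) (first_map M' g') (first_map M g)"
proof
  fix x
  have "x \<in> carrier (total_part M)" "g x \<in> first_part M'" if "x \<in> first_part M"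
    using that g strictly_zero_dimensionalD(3)[OF M] by (auto simp: biframe_hom_def subframe_def)
  then show "first_map M (compose (carrier (total_part M)) g' g) x =
      compose (carrier (first_frame M)) (first_map M' g') (first_map M g) x"
    by (cases "x \<in> first_part M") (simp_all add: first_map_def compose_def)
qed

lemma first_map_id:
  assumes "strictly_zero_dimensional M"
  shows "first_map M (\<lambda>x\<in>carrier (total_part M). x) = (\<lambda>x\<in>carrier (first_frame M). x)"
  using strictly_zero_dimensionalD(3)[OF assms]
  by (auto simp: first_map_def fun_eq_iff subframe_def restrict_def)

lemma hom_transpose_natural_frame:
  assumes L: "frame L" and L': "frame L'" and f: "f \<in> frame_hom L L'"
  shows "hom_transpose L (compose (carrier (cong_frame L)) g (cong_map L L' f)) =
    compose (carrier L) (hom_transpose L' g) f"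
proof (rule extensionalityI[where A = "carrier L"])
  fix a assume a: "a \<in> carrier L"
  then show "hom_transpose L (compose (carrier (cong_frame L)) g (cong_map L L' f)) a =
      compose (carrier L) (hom_transpose L' g) f a"
    using frame_hom_closed[OF L L' f a]
    by (simp add: hom_transpose_apply compose_eq frame_congruence_nabla[OF L] cong_map_nabla[OF L L' f])
qed (simp_all add: hom_transpose_def compose_def)

lemma hom_transpose_natural_biframe:
  assumes L: "frame L" and g: "g \<in> biframe_hom (cong_biframe L) M"
  shows "hom_transpose L (compose (carrier (cong_frame L)) h g) =
    compose (carrier L) (first_map M h) (hom_transpose L g)"
proof (rule extensionalityI[where A = "carrier L"])
  fix a assume a: "a \<in> carrier L"
  then have "g (nabla L a) \<in> first_part M" using g by (auto simp: biframe_hom_def)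
  then show "hom_transpose L (compose (carrier (cong_frame L)) h g) a =
      compose (carrier L) (first_map M h) (hom_transpose L g) a"
    using a by (simp add: hom_transpose_apply compose_eq frame_congruence_nabla[OF L] first_map_def)
qed (simp_all add: hom_transpose_def compose_def)

theorem mainTheorem9:
  shows
    \<comment> \<open>the congruence biframe functor, from frames to strictly zero-dimensional biframes\<close>
    "(\<forall>L :: 'a gorder. frame L \<longrightarrow> strictly_zero_dimensional (cong_biframe L)) \<and>
     (\<forall>(L :: 'a gorder) (L' :: 'b gorder). frame L \<longrightarrow> frame L' \<longrightarrow>
        (\<forall>f \<in> frame_hom L L'.
           (\<exists>!g. is_cong_map L L' f g) \<and>
           cong_map L L' f \<in> biframe_hom (cong_biframe L) (cong_biframe L'))) \<and>
     (\<forall>L :: 'a gorder. frame L \<longrightarrow>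
        cong_map L L (\<lambda>x\<in>carrier L. x) = (\<lambda>\<theta>\<in>carrier (cong_frame L). \<theta>)) \<and>
     (\<forall>(L :: 'a gorder) (L' :: 'b gorder) (L'' :: 'c gorder).
        frame L \<longrightarrow> frame L' \<longrightarrow> frame L'' \<longrightarrow>
        (\<forall>f \<in> frame_hom L L'. \<forall>f' \<in> frame_hom L' L''.
           cong_map L L'' (compose (carrier L) f' f) =
           compose (carrier (cong_frame L)) (cong_map L' L'' f') (cong_map L L' f))) \<and>
     \<comment> \<open>the first part functor, from strictly zero-dimensional biframes to frames\<close>
     (\<forall>M :: 'd biframe. strictly_zero_dimensional M \<longrightarrow> frame (first_frame M)) \<and>
     (\<forall>(M :: 'd biframe) (M' :: 'e biframe).
        strictly_zero_dimensional M \<longrightarrow> strictly_zero_dimensional M' \<longrightarrow>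
        (\<forall>g \<in> biframe_hom M M'. first_map M g \<in> frame_hom (first_frame M) (first_frame M'))) \<and>
     (\<forall>M :: 'd biframe. strictly_zero_dimensional M \<longrightarrow>
        first_map M (\<lambda>x\<in>carrier (total_part M). x) = (\<lambda>x\<in>carrier (first_frame M). x)) \<and>
     (\<forall>(M :: 'd biframe) (M' :: 'e biframe) (M'' :: 'f biframe).
        strictly_zero_dimensional M \<longrightarrow> strictly_zero_dimensional M' \<longrightarrow>
        strictly_zero_dimensional M'' \<longrightarrow>
        (\<forall>g \<in> biframe_hom M M'. \<forall>g' \<in> biframe_hom M' M''.
           first_map M (compose (carrier (total_part M)) g' g) =
           compose (carrier (first_frame M)) (first_map M' g') (first_map M g))) \<and>
     \<comment> \<open>the bijection of hom-sets\<close>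
     (\<forall>(L :: 'a gorder) (M :: 'd biframe). frame L \<longrightarrow> strictly_zero_dimensional M \<longrightarrow>
        bij_betw (hom_transpose L) (biframe_hom (cong_biframe L) M) (frame_hom L (first_frame M))) \<and>
     \<comment> \<open>naturality in the frame\<close>
     (\<forall>(L :: 'a gorder) (L' :: 'b gorder) (M :: 'd biframe).
        frame L \<longrightarrow> frame L' \<longrightarrow> strictly_zero_dimensional M \<longrightarrow>
        (\<forall>f \<in> frame_hom L L'. \<forall>g \<in> biframe_hom (cong_biframe L') M.
           hom_transpose L (compose (carrier (cong_frame L)) g (cong_map L L' f)) =
           compose (carrier L) (hom_transpose L' g) f)) \<and>
     \<comment> \<open>naturality in the biframe\<close>
     (\<forall>(L :: 'a gorder) (M :: 'd biframe) (M' :: 'e biframe).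
        frame L \<longrightarrow> strictly_zero_dimensional M \<longrightarrow> strictly_zero_dimensional M' \<longrightarrow>
        (\<forall>g \<in> biframe_hom (cong_biframe L) M. \<forall>h \<in> biframe_hom M M'.
           hom_transpose L (compose (carrier (cong_frame L)) h g) =
           compose (carrier L) (first_map M h) (hom_transpose L g)))"
proof (intro conjI allI impI ballI)
  fix L :: "'a gorder" and M :: "'d biframe" and M' :: "'e biframe" and g h
  assume "frame L" "strictly_zero_dimensional M" "strictly_zero_dimensional M'"
    "g \<in> biframe_hom (cong_biframe L) M" "h \<in> biframe_hom M M'"
  then show "hom_transpose L (compose (carrier (cong_frame L)) h g) =
      compose (carrier L) (first_map M h) (hom_transpose L g)"
    by (intro hom_transpose_natural_biframe)
qed (assumption | rule cong_biframe_strictly_zero_dimensional cong_map_ex1 cong_map_biframe_hom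
    cong_map_id cong_map_compose
    first_frame_frame first_map_frame_hom first_map_id first_map_compose hom_transpose_bij
    hom_transpose_natural_frame)+

end
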